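(* Let $\{\lambda_m\}_{m=1}^{M}$ and $\{\mu_n\}_{n=1}^{N}$ be nonnegative and nonincreasing sequences of real numbers, where $M\leq N$. There exists a sequence of vectors $F=\{f_n\}_{n=1}^{N}$ in $\mathbb{C}^M$ whose frame operator $FF^*$ has spectrum $\{\lambda_m\}_{m=1}^{M}$ and for which $\|f_n\|^2=\mu_n$ for all $n=1,\dots,N$ if and only if $\{\lambda_m\}_{m=1}^{M}\cup\{0\}_{m=M+1}^N\succeq\{\mu_n\}_{n=1}^{N}$. Moreover, if $\{\lambda_m\}_{m=1}^{M}\cup\{0\}_{m=M+1}^N\succeq\{\mu_n\}_{n=1}^{N}$, then every such $F$ can be constructed by the following process: Step A. Let $\lambda_{N;m}:=\lambda_m$ for $m=1,\dots,M$. For $n=N,N-1,\ldots,2$ (in this order), construct $\{\lambda_{n-1;m}\}_{m=1}^M$ in terms of $\{\lambda_{n;m}\}_{m=1}^{M}$ as follows: for each $k=M,M-1,\ldots,1$ (in this order), if $k>n-1$, take $\lambda_{n-1;k}:=0$; otherwise, pick any $\lambda_{n-1;k}\in[A_{n-1;k},B_{n-1;k}]$, where $$A_{n-1;k}:=\max \bigg\{ \lambda_{n;k+1},\ \sum_{m=k}^{M} \lambda_{n;m} - \sum_{m=k+1}^{M} \lambda_{n-1;m} - \mu_n \bigg\},$$ $$B_{n-1;k}:=\min \bigg\{ \lambda_{n;k},\ \min_{l=1,\dots,k} \bigg\{\sum_{m=l}^{n-1} \mu_m - \sum_{m=l+1}^{k} \lambda_{n;m} - \sum_{m=k+1}^{M}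 \lambda_{n-1;m} \bigg\}\bigg\}.$$ Here the convention is that $\lambda_{n;M+1}=0$, and that sums over empty sets of indices are zero. Step B. For each $n=1,\dots,N$, consider the polynomial $p_n(x):=\prod_{m=1}^{M}(x-\lambda_{n;m})$. Take any $f_1\in\mathbb{C}^M$ such that $\|f_1\|^2=\mu_1$. For each $n=1,\dots,N-1$ (successively), choose any $f_{n+1}\in\mathbb{C}^M$ such that $$\|P_{n;\lambda}f_{n+1}\|^2=-\lim_{x\rightarrow\lambda}(x-\lambda)\frac{p_{n+1}(x)}{p_n(x)}\qquad \text{for all } \lambda\in\{\lambda_{n;m}\}_{m=1}^M,$$ where $P_{n;\lambda}$ denotes the orthogonal projection of $\mathbb{C}^M$ onto the eigenspace $\ker(\lambda \mathrm{I}-F_nF_n^* )$ of the frame operator $F_nF_n^*$ of $F_n:=\{f_m\}_{m=1}^{n}$ (the limit necessarily exists and is nonpositive). Conversely, any $F$ constructed by this process has $\{\lambda_m\}_{m=1}^{M}$ as the spectrum of $FF^*$ and $\|f_n\|^2=\mu_n$ for all $n$, and moreover, $F_nF_n^*$ has spectrum $\{\lambda_{n;m}\}_{m=1}^{M}$ for every $n=1,\dots,N$.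
   Context: A sequence of vectors $F=\{f_n\}_{n=1}^N$ in $\mathbb{C}^M$ is identified with its synthesis operator, the $M\times N$ complex matrix $F$ whose columns are the $f_n$'s; its frame operator is the $M\times M$ matrix $FF^*=\sum_{n=1}^N f_nf_n^*$. For $n=1,\dots,N$, $F_n=\{f_m\}_{m=1}^n$ denotes the partial sequence (an $M\times n$ matrix), with frame operator $F_nF_n^*=\sum_{m=1}^n f_mf_m^*$. Spectra are listed with multiplicity, in nonincreasing order. Majorization: for nonincreasing real sequences $\{\lambda_n\}_{n=1}^N$ and $\{\mu_n\}_{n=1}^N$, one writes $\{\lambda_n\}_{n=1}^N\succeq\{\mu_n\}_{n=1}^N$ if $\sum_{m=1}^n\lambda_m\geq\sum_{m=1}^n\mu_m$ for all $n=1,\dots,N-1$ and $\sum_{m=1}^N\lambda_m=\sum_{m=1}^N\mu_m$. $\{\lambda_m\}_{m=1}^{M}\cup\{0\}_{m=M+1}^N$ denotes the sequence $\{\lambda_m\}_{m=1}^M$ padded with $N-M$ zeros to a sequence of length $N$. *)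

theory Defs
  imports "HOL-Analysis.Analysis" "Jordan_Normal_Form.Schur_Decomposition"
    "Jordan_Normal_Form.Matrix_Kernel"
begin

text \<open>Finite sequences indexed by \<open>1..n\<close> are total functions on \<open>nat\<close> whose values outside
  \<open>{1..n}\<close> are never used.\<close>

definition pad :: "nat \<Rightarrow> (nat \<Rightarrow> real) \<Rightarrow> nat \<Rightarrow> real" where
  "pad M s m = (if m \<le> M then s m else 0)"

definition majorizes :: "nat \<Rightarrow> (nat \<Rightarrow> real) \<Rightarrow> (nat \<Rightarrow> real) \<Rightarrow> bool" where
  "majorizes N a b \<longleftrightarrow>
     (\<forall>n\<in>{1..N-1}. (\<Sum>m=1..n. a m) \<ge> (\<Sum>m=1..n. b m)) \<and>
     (\<Sum>m=1..N. a m) = (\<Sum>m=1..N. b m)"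

definition vnorm :: "complex vec \<Rightarrow> real" where
  "vnorm v = sqrt (Re (v \<bullet>c v))"

text \<open>The synthesis operator of \<open>f\<^sub>1, \<dots>, f\<^sub>n\<close> in \<open>\<complex>\<^sup>M\<close>, and its frame operator.\<close>

definition synth :: "nat \<Rightarrow> nat \<Rightarrow> (nat \<Rightarrow> complex vec) \<Rightarrow> complex mat" where
  "synth M n f = mat_of_cols M (map f [1..<Suc n])"

definition frame_op :: "nat \<Rightarrow> nat \<Rightarrow> (nat \<Rightarrow> complex vec) \<Rightarrow> complex mat" where
  "frame_op M n f = synth M n f * mat_adjoint (synth M n f)"

text \<open>Spectra are listed with multiplicity and in nonincreasing order.\<close>

definition has_spectrum :: "nat \<Rightarrow> complex mat \<Rightarrow> (nat \<Rightarrow> real) \<Rightarrow> bool" where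
  "has_spectrum M A s \<longleftrightarrow>
     antimono_on {1..M} s \<and>
     char_poly A = (\<Prod>m=1..M. [:- complex_of_real (s m), 1:])"

definition frame_with ::
  "nat \<Rightarrow> nat \<Rightarrow> (nat \<Rightarrow> real) \<Rightarrow> (nat \<Rightarrow> real) \<Rightarrow> (nat \<Rightarrow> complex vec) \<Rightarrow> bool" where
  "frame_with M N lam mu f \<longleftrightarrow>
     (\<forall>n\<in>{1..N}. f n \<in> carrier_vec M) \<and>
     has_spectrum M (frame_op M N f) lam \<and>
     (\<forall>n\<in>{1..N}. (vnorm (f n))\<^sup>2 = mu n)"

text \<open>In Step A, \<open>L n m\<close> stands for \<open>\<lambda>\<^bsub>n;m\<^esub>\<close>. The bounds and the choice below, at arguments
  \<open>n\<close> and \<open>k\<close>, concern \<open>\<lambda>\<^bsub>n-1;k\<^esub>\<close>; \<open>pad\<close> encodes the convention \<open>\<lambda>\<^bsub>n;M+1\<^esub> = 0\<close>.\<close>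

definition A_bound :: "nat \<Rightarrow> (nat \<Rightarrow> real) \<Rightarrow> (nat \<Rightarrow> nat \<Rightarrow> real) \<Rightarrow> nat \<Rightarrow> nat \<Rightarrow> real" where
  "A_bound M mu L n k =
     max (pad M (L n) (k + 1))
         ((\<Sum>m=k..M. L n m) - (\<Sum>m=k+1..M. L (n-1) m) - mu n)"

definition B_bound :: "nat \<Rightarrow> (nat \<Rightarrow> real) \<Rightarrow> (nat \<Rightarrow> nat \<Rightarrow> real) \<Rightarrow> nat \<Rightarrow> nat \<Rightarrow> real" where
  "B_bound M mu L n k =
     min (L n k)
         (Min ((\<lambda>l. (\<Sum>m=l..n-1. mu m) - (\<Sum>m=l+1..k. L n m) - (\<Sum>m=k+1..M. L (n-1) m)) ` {1..k}))"

definition stepA_choice ::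
  "nat \<Rightarrow> (nat \<Rightarrow> real) \<Rightarrow> (nat \<Rightarrow> nat \<Rightarrow> real) \<Rightarrow> nat \<Rightarrow> nat \<Rightarrow> bool" where
  "stepA_choice M mu L n k \<longleftrightarrow>
     (if k > n - 1 then L (n-1) k = 0
      else L (n-1) k \<in> {A_bound M mu L n k .. B_bound M mu L n k})"

definition stepA ::
  "nat \<Rightarrow> nat \<Rightarrow> (nat \<Rightarrow> real) \<Rightarrow> (nat \<Rightarrow> real) \<Rightarrow> (nat \<Rightarrow> nat \<Rightarrow> real) \<Rightarrow> bool" where
  "stepA M N lam mu L \<longleftrightarrow>
     (\<forall>m\<in>{1..M}. L N m = lam m) \<and>
     (\<forall>n\<in>{2..N}. \<forall>k\<in>{1..M}. stepA_choice M mu L n k)"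

text \<open>The state of Step A just before \<open>\<lambda>\<^bsub>n-1;k\<^esub>\<close> is chosen: the choices already made are those at
  \<open>(j, i)\<close> with \<open>j > n\<close>, or \<open>j = n\<close> and \<open>i > k\<close>.\<close>

definition stepA_before ::
  "nat \<Rightarrow> nat \<Rightarrow> (nat \<Rightarrow> real) \<Rightarrow> (nat \<Rightarrow> real) \<Rightarrow> (nat \<Rightarrow> nat \<Rightarrow> real) \<Rightarrow> nat \<Rightarrow> nat \<Rightarrow> bool" where
  "stepA_before M N lam mu L n k \<longleftrightarrow>
     (\<forall>m\<in>{1..M}. L N m = lam m) \<and>
     (\<forall>j\<in>{2..N}. \<forall>i\<in>{1..M}. j > n \<or> j = n \<and> i > k \<longrightarrow> stepA_choice M mu L j i)"

definition spec_poly :: "nat \<Rightarrow> (nat \<Rightarrow> real) \<Rightarrow> real poly" where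
  "spec_poly M s = (\<Prod>m=1..M. [:- s m, 1:])"

text \<open>The function \<open>t \<mapsto> (t - x) p\<^bsub>n+1\<^esub>(t) / p\<^bsub>n\<^esub>(t)\<close>, whose limit at \<open>x\<close> is taken in Step B.\<close>

definition residue_fun :: "nat \<Rightarrow> (nat \<Rightarrow> nat \<Rightarrow> real) \<Rightarrow> nat \<Rightarrow> real \<Rightarrow> real \<Rightarrow> real" where
  "residue_fun M L n x t =
     (t - x) * (poly (spec_poly M (L (n+1))) t / poly (spec_poly M (L n)) t)"

definition eigenspace :: "nat \<Rightarrow> complex mat \<Rightarrow> complex \<Rightarrow> complex vec set" where
  "eigenspace M A x = mat_kernel (x \<cdot>\<^sub>m 1\<^sub>m M - A)"

text \<open>The orthogonal projection of \<open>v\<close> onto a linear subspace \<open>W\<close> of \<open>\<complex>\<^sup>d\<close>, \<open>d = dim_vec v\<close>;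
  unspecified when \<open>W\<close> is not such a subspace.\<close>

definition orth_proj :: "complex vec set \<Rightarrow> complex vec \<Rightarrow> complex vec" where
  "orth_proj W v = (THE w. w \<in> W \<and> (\<forall>u\<in>W. (v - w) \<bullet>c u = 0))"

text \<open>\<open>v\<close> is an allowed choice for \<open>f\<^bsub>n+1\<^esub>\<close> in Step B, given \<open>f\<^sub>1, \<dots>, f\<^sub>n\<close>. Existence of the limit
  is part of the condition.\<close>

definition stepB_choice ::
  "nat \<Rightarrow> (nat \<Rightarrow> nat \<Rightarrow> real) \<Rightarrow> (nat \<Rightarrow> complex vec) \<Rightarrow> nat \<Rightarrow> complex vec \<Rightarrow> bool" where
  "stepB_choice M L f n v \<longleftrightarrow>
     v \<in> carrier_vec M \<and>
     (\<forall>x \<in> L n ` {1..M}.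
        (residue_fun M L n x \<longlongrightarrow>
           - (vnorm (orth_proj (eigenspace M (frame_op M n f) (complex_of_real x)) v))\<^sup>2) (at x))"

text \<open>Step B has been carried out up to and including \<open>f\<^sub>n\<close> (\<open>n \<ge> 1\<close>).\<close>

definition stepB ::
  "nat \<Rightarrow> (nat \<Rightarrow> real) \<Rightarrow> (nat \<Rightarrow> nat \<Rightarrow> real) \<Rightarrow> nat \<Rightarrow> (nat \<Rightarrow> complex vec) \<Rightarrow> bool" where
  "stepB M mu L n f \<longleftrightarrow>
     f 1 \<in> carrier_vec M \<and> (vnorm (f 1))\<^sup>2 = mu 1 \<and>
     (\<forall>j\<in>{1..<n}. stepB_choice M L f j (f (j+1)))"

end

theory Submission
  imports Defs
begin

text \<open>
  The frame operators of the partial sequences satisfy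
  \<open>F\<^sub>n\<^sub>+\<^sub>1 F\<^sub>n\<^sub>+\<^sub>1\<^sup>* = F\<^sub>n F\<^sub>n\<^sup>* + f\<^sub>n\<^sub>+\<^sub>1 f\<^sub>n\<^sub>+\<^sub>1\<^sup>*\<close>, so everything rests on what adding
  \<open>v v\<^sup>*\<close> does to the spectrum of a self-adjoint matrix \<open>A\<close>. If \<open>u\<^sub>1, \<dots>, u\<^sub>M\<close> is an orthonormal basis
  of eigenvectors with eigenvalues \<open>s\<^sub>i\<close>, the matrix determinant lemma expresses the quotient of the
  two characteristic polynomials as \<open>1 - (\<Sum>i. |\<langle>v, u\<^sub>i\<rangle>|\<^sup>2 / (x - s\<^sub>i))\<close> (\<open>spec_poly_ratio\<close>). Its residue at an
  eigenvalue \<open>x\<close> is minus the squared length of the projection of \<open>v\<close> to the eigenspace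
  (\<open>residue_limit\<close>), and since both polynomials are monic of the same degree, the residues determine
  the new spectrum (\<open>spec_poly_eqI\<close>). Hence the condition of Step B on \<open>f\<^sub>n\<^sub>+\<^sub>1\<close> says exactly that
  \<open>F\<^sub>n\<^sub>+\<^sub>1 F\<^sub>n\<^sub>+\<^sub>1\<^sup>*\<close> has the prescribed spectrum, and it can be met because the prescribed residues are
  nonpositive when consecutive rows interlace (\<open>interlacing_residue_nonpos\<close>).

  It remains to see that Step A enumerates exactly the tables of spectra that frames can have.
  Call a table an eigenstep table if consecutive rows interlace and row \<open>n\<close> is nonincreasing,
  nonnegative, zero beyond index \<open>n\<close>, and majorizes \<open>\<mu>\<^sub>1, \<dots>, \<mu>\<^sub>n\<close>. The spectra of a frame form such a
  table: interlacing is the Courant-Fischer argument (\<open>interlacing_add_rank_one\<close>), traces give the row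
  sums, and interlacing together with the row sums gives the majorization (\<open>eigensteps_of_frame\<close>); in
  particular the last row majorizes \<open>\<mu>\<close>. Conversely, the bounds of Step A are the interlacing
  inequalities together with those consequences of majorization and trace that involve the entries
  chosen so far (\<open>row_of_choices\<close>, \<open>interlacing_row_is_choice\<close>). The interval they leave is never empty,
  because each inequality between a lower and an upper bound is either a property of row \<open>n\<close> or was
  already imposed on the previously chosen entry (\<open>choice_possible\<close>).
\<close>

section \<open>Interlacing rows and Step A\<close>

unbundle no vec_syntax

text \<open>The larger row comes first. Padding with zero makes the last condition read \<open>0 \<le> s M\<close>.\<close>

definition interlaces :: "nat \<Rightarrow> (nat \<Rightarrow> real) \<Rightarrow> (nat \<Rightarrow> real) \<Rightarrow> bool" where
  "interlaces M r s \<longleftrightarrow> (\<forall>k\<in>{1..M}. pad M r (k+1) \<le> s k \<and> s k \<le> r k)"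

text \<open>A row that can occur as the spectrum of \<open>F\<^sub>n F\<^sub>n\<^sup>*\<close>. The majorization of \<open>\<mu>\<^sub>1, \<dots>, \<mu>\<^sub>n\<close> is expressed by
  tail sums, the form in which Step A, choosing entries from the last index downwards, meets it.\<close>

definition good_row :: "nat \<Rightarrow> (nat \<Rightarrow> real) \<Rightarrow> nat \<Rightarrow> (nat \<Rightarrow> real) \<Rightarrow> bool" where
  "good_row M mu n s \<longleftrightarrow>
     antimono_on {1..M} s \<and> (\<forall>k\<in>{1..M}. 0 \<le> s k) \<and> (\<forall>k\<in>{1..M}. n < k \<longrightarrow> s k = 0) \<and>
     (\<forall>k\<in>{1..M}. (\<Sum>m=k..M. s m) \<le> (\<Sum>m=k..n. mu m)) \<and>
     (\<Sum>m=1..M. s m) = (\<Sum>m=1..n. mu m)"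

lemma antimono_on_atLeastAtMost_Suc:
  fixes s :: "nat \<Rightarrow> real"
  assumes "\<And>k. 1 \<le> k \<Longrightarrow> k < M \<Longrightarrow> s (Suc k) \<le> s k"
  shows "antimono_on {1..M} s"
proof (rule monotone_onI)
  fix x y assume xy: "x \<in> {1..M}" "y \<in> {1..M}" "x \<le> y"
  from xy(3) xy(2) show "s y \<le> s x"
  proof (induction y rule: dec_induct)
    case (step n)
    then have "s n \<le> s x" "s (Suc n) \<le> s n" using xy(1) assms by auto
    then show ?case by simp
  qed simp
qed

lemma antimono_on_atLeastAtMostD:
  fixes s :: "nat \<Rightarrow> real"
  assumes "antimono_on {1..M} s" "1 \<le> i" "i \<le> j" "j \<le> M"
  shows "s j \<le> s i"
  using monotone_onD[OF assms(1), of i j] assms by auto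

lemma sum_pop_front:
  fixes f :: "nat \<Rightarrow> real"
  shows "k \<le> M \<Longrightarrow> (\<Sum>m=k..M. f m) = f k + (\<Sum>m=k+1..M. f m)"
  by (simp add: sum.atLeast_Suc_atMost)

lemma sum_split_at:
  fixes f :: "nat \<Rightarrow> real"
  shows "1 \<le> k \<Longrightarrow> k - 1 \<le> M \<Longrightarrow> (\<Sum>m=1..M. f m) = (\<Sum>m=1..k-1. f m) + (\<Sum>m=k..M. f m)"
  using sum.ub_add_nat[of 1 "k-1" f "M - (k-1)"] by simp

lemma B_bound_le:
  assumes "l \<in> {1..k}"
  shows "B_bound M mu L n k
    \<le> (\<Sum>m=l..n-1. mu m) - (\<Sum>m=l+1..k. L n m) - (\<Sum>m=k+1..M. L (n-1) m)"
  unfolding B_bound_def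
  by (rule min.coboundedI2, rule Min_le, simp, rule imageI, rule assms)

lemma good_rowD:
  assumes "good_row M mu n s"
  shows "\<And>i j. 1 \<le> i \<Longrightarrow> i \<le> j \<Longrightarrow> j \<le> M \<Longrightarrow> s j \<le> s i"
    and "\<And>k. 1 \<le> k \<Longrightarrow> k \<le> M \<Longrightarrow> 0 \<le> s k"
    and "\<And>k. n < k \<Longrightarrow> k \<le> M \<Longrightarrow> s k = 0"
    and "\<And>k. 1 \<le> k \<Longrightarrow> k \<le> M \<Longrightarrow> (\<Sum>m=k..M. s m) \<le> (\<Sum>m=k..n. mu m)"
    and "(\<Sum>m=1..M. s m) = (\<Sum>m=1..n. mu m)"
proof -
  show "\<And>i j. 1 \<le> i \<Longrightarrow> i \<le> j \<Longrightarrow> j \<le> M \<Longrightarrow> s j \<le> s i"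
    using assms antimono_on_atLeastAtMostD unfolding good_row_def by blast
qed (use assms in \<open>auto simp: good_row_def\<close>)

lemma good_row_tail:
  assumes "good_row M mu n s" "1 \<le> k" "\<And>m. m \<in> {1..n} \<Longrightarrow> 0 \<le> mu m"
  shows "(\<Sum>m=k..M. s m) \<le> (\<Sum>m=k..n. mu m)"
proof (cases "k \<le> M")
  case False
  then show ?thesis using assms by (auto intro!: sum_nonneg)
qed (use good_rowD(4)[OF assms(1)] assms in auto)

text \<open>Writing \<open>s\<close> for row \<open>n\<close> and \<open>t\<close> for row \<open>n - 1\<close>, each of the two lower bounds has to be compared with
  each upper bound. The only comparison that does not follow from properties of \<open>s\<close> alone or from the
  lower bound for \<open>t\<^sub>k\<^sub>+\<^sub>1\<close> is that of \<open>s\<^sub>k\<^sub>+\<^sub>1\<close> with the upper bound of index \<open>l\<close>; this is literally the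
  upper bound of index \<open>l\<close> that was imposed on \<open>t\<^sub>k\<^sub>+\<^sub>1\<close>. When \<open>t\<^sub>k\<^sub>+\<^sub>1\<close> was not chosen but is zero or absent,
  the majorization for \<open>s\<close> and the monotonicity of \<open>\<mu>\<close> take its place.\<close>

lemma choice_possible:
  assumes row: "good_row M mu n (L n)" and n: "2 \<le> n"
    and mu0: "\<And>m. m \<in> {1..n} \<Longrightarrow> 0 \<le> mu m"
    and mu_anti: "antimono_on {1..n} mu"
    and k: "k \<in> {1..M}" "k \<le> n - 1"
    and before: "\<And>i. i \<in> {1..M} \<Longrightarrow> k < i \<Longrightarrow> stepA_choice M mu L n i"
  shows "A_bound M mu L n k \<le> B_bound M mu L n k"
proof -
  let ?s = "L n" and ?t = "L (n - 1)"
  note good = good_rowD[OF row]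
  have n': "n = Suc (n - 1)" using n by simp
  have mu_split: "(\<Sum>m=l..n. mu m) = (\<Sum>m=l..n-1. mu m) + mu n" if "l \<le> n" for l
    using that n' sum.nat_ivl_Suc'[of l "n-1" mu] by (metis add.commute)
  have shift: "(\<Sum>m=l+1..n. mu m) \<le> (\<Sum>m=l..n-1. mu m)" if "1 \<le> l" for l
  proof -
    have "(\<Sum>m=l+1..n. mu m) = (\<Sum>m=l..n-1. mu (Suc m))"
      using sum.shift_bounds_cl_Suc_ivl[of mu l "n-1"] n' by simp
    also have "\<dots> \<le> (\<Sum>m=l..n-1. mu m)"
      using antimono_on_atLeastAtMostD[OF mu_anti] that n by (intro sum_mono) auto
    finally show ?thesis .
  qed
  have tail: "(\<Sum>m=l..M. ?s m) \<le> (\<Sum>m=l..n. mu m)" if "1 \<le> l" for l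
    using good_row_tail[OF row that mu0] .
  have next_choice: "?t (k+1) \<in> {A_bound M mu L n (k+1)..B_bound M mu L n (k+1)}"
    if "k + 1 \<le> M" "k + 1 \<le> n - 1"
    using before[of "k+1"] that by (auto simp: stepA_choice_def)
  have t0: "(\<Sum>m=k+1..M. ?t m) = 0" if "k + 1 > n - 1"
    using before that by (intro sum.neutral) (auto simp: stepA_choice_def)
  have s0: "(\<Sum>m=n+1..M. ?s m) = 0"
    using good(3) by (intro sum.neutral) auto
  (* The comparisons 1 and 2 are those of s(k+1), the comparisons 3 and 4 those of the trace bound. *)
  have 1: "pad M ?s (k+1) \<le> ?s k"
    using good(1)[of k "k+1"] good(2)[of k] k by (auto simp: pad_def)
  have 2: "(\<Sum>m=l+1..k. ?s m) + pad M ?s (k+1) + (\<Sum>m=k+1..M. ?t m) \<le> (\<Sum>m=l..n-1. mu m)"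
    if l: "l \<in> {1..k}" for l
  proof (cases "k + 1 \<le> M \<and> k + 1 \<le> n - 1")
    case True
    have "?t (k+1) \<le> (\<Sum>m=l..n-1. mu m) - (\<Sum>m=l+1..k+1. ?s m) - (\<Sum>m=k+1+1..M. ?t m)"
      using next_choice[THEN atLeastAtMost_iff[THEN iffD1]] True l
        B_bound_le[of l "k+1" M mu L n] by force
    moreover have "(\<Sum>m=l+1..k+1. ?s m) = (\<Sum>m=l+1..k. ?s m) + ?s (k+1)" using l by simp
    ultimately show ?thesis using sum_pop_front[of "k+1" M ?t] True by (simp add: pad_def)
  next
    case False
    have "(\<Sum>m=k+1..M. ?t m) = 0" using False t0 by (cases "k + 1 \<le> M") auto
    moreover have "(\<Sum>m=l+1..k. ?s m) + pad M ?s (k+1) = (\<Sum>m=l+1..M. ?s m)"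
    proof (cases "k + 1 \<le> M")
      case True
      then have kn: "k + 1 = n" using False k n by auto
      have "(\<Sum>m=l+1..M. ?s m) = (\<Sum>m=l+1..k+1. ?s m) + (\<Sum>m=n+1..M. ?s m)"
        using sum.ub_add_nat[of "l+1" "k+1" ?s "M - (k+1)"] True l kn by (simp del: sum.cl_ivl_Suc)
      also have "(\<Sum>m=l+1..k+1. ?s m) = (\<Sum>m=l+1..k. ?s m) + ?s (k+1)" using l by simp
      finally show ?thesis using True s0 by (simp add: pad_def)
    next
      case False
      then have "k = M" using k by simp
      then show ?thesis by (simp add: pad_def)
    qed
    ultimately show ?thesis using tail[of "l+1"] shift[of l] l by auto
  qed
  have 3: "(\<Sum>m=k..M. ?s m) - (\<Sum>m=k+1..M. ?t m) - mu n \<le> ?s k"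
  proof (cases "k + 1 \<le> M \<and> k + 1 \<le> n - 1")
    case True
    have "(\<Sum>m=k+1..M. ?s m) - (\<Sum>m=k+1+1..M. ?t m) - mu n \<le> ?t (k+1)"
      using next_choice True unfolding A_bound_def by auto
    then show ?thesis using sum_pop_front[of "k+1" M ?t] sum_pop_front[of k M ?s] True by simp
  next
    case False
    have "(\<Sum>m=k+1..M. ?t m) = 0" using False t0 by (cases "k + 1 \<le> M") auto
    moreover have "(\<Sum>m=k+1..M. ?s m) \<le> mu n"
    proof (cases "k + 1 \<le> M")
      case True
      then have "k + 1 = n" using False k n by auto
      then show ?thesis using tail[of n] n by simp
    qed (use mu0[of n] n in auto)
    ultimately show ?thesis using sum_pop_front[of k M ?s] k by simp
  qed
  have 4: "(\<Sum>m=k..M. ?s m) - mu n \<le> (\<Sum>m=l..n-1. mu m) - (\<Sum>m=l+1..k. ?s m)"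
    if l: "l \<in> {1..k}" for l
  proof -
    have "(\<Sum>m=k..M. ?s m) + (\<Sum>m=l+1..k. ?s m) = ?s k + (\<Sum>m=l+1..M. ?s m)"
      using sum.ub_add_nat[of "l+1" k ?s "M-k"] sum_pop_front[of k M ?s] k l by simp
    also have "\<dots> \<le> ?s l + (\<Sum>m=l+1..M. ?s m)" using good(1)[of l k] l k by simp
    also have "\<dots> = (\<Sum>m=l..M. ?s m)" using sum_pop_front[of l M ?s] l k by simp
    also have "\<dots> \<le> (\<Sum>m=l..n-1. mu m) + mu n" using tail[of l] mu_split[of l] l k by (cases "l \<le> n") auto
    finally show ?thesis by simp
  qed
  (* Goals 4 and 8 compare a lower bound with the minimum over l; the others are immediate. *)
  show ?thesis
    unfolding A_bound_def B_bound_def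
  proof (intro max.boundedI min.boundedI Min.boundedI, goal_cases)
    case (4 a) then show ?case using 2 by force
  next
    case (8 a) then show ?case using 4 by force
  qed (use 1 3 k in auto)
qed

text \<open>The upper bound of index \<open>l = k\<close> is the majorization inequality for the tail from \<open>k\<close>. At \<open>k = 1\<close> the
  second lower bound turns it into the equality of the total sums.\<close>

lemma row_of_choices:
  assumes row: "good_row M mu n (L n)" and n: "2 \<le> n"
    and M: "1 \<le> M"
    and mu0: "\<And>m. m \<in> {1..n} \<Longrightarrow> 0 \<le> mu m"
    and ch: "\<And>i. i \<in> {1..M} \<Longrightarrow> stepA_choice M mu L n i"
  shows "good_row M mu (n-1) (L (n-1))" "interlaces M (L n) (L (n-1))"
proof -
  let ?s = "L n" and ?t = "L (n - 1)"
  note good = good_rowD[OF row]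
  have zero: "?t k = 0" if "k \<in> {1..M}" "n - 1 < k" for k
    using ch[OF that(1)] that by (auto simp: stepA_choice_def)
  have range: "A_bound M mu L n k \<le> ?t k" "?t k \<le> B_bound M mu L n k"
    if "k \<in> {1..M}" "k \<le> n - 1" for k
    using ch[OF that(1)] that by (auto simp: stepA_choice_def)
  have ilc: "pad M ?s (k+1) \<le> ?t k \<and> ?t k \<le> ?s k" if k: "k \<in> {1..M}" for k
  proof (cases "k \<le> n - 1")
    case True
    then show ?thesis using range[OF k] by (auto simp: A_bound_def B_bound_def)
  next
    case False
    then show ?thesis using zero[OF k] good(2)[of k] good(3)[of "k+1"] k by (auto simp: pad_def)
  qed
  then show "interlaces M ?s ?t" by (auto simp: interlaces_def)
  have nn: "0 \<le> ?t k" if k: "k \<in> {1..M}" for k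
    using ilc[OF k] good(2)[of "k+1"] by (auto simp: pad_def split: if_splits)
  have anti: "antimono_on {1..M} ?t"
  proof (rule antimono_on_atLeastAtMost_Suc)
    fix k assume "1 \<le> k" "k < M"
    then show "?t (Suc k) \<le> ?t k" using ilc[of k] ilc[of "k+1"] by (auto simp: pad_def)
  qed
  have tail: "(\<Sum>m=k..M. ?t m) \<le> (\<Sum>m=k..n-1. mu m)" if k: "k \<in> {1..M}" for k
  proof (cases "k \<le> n - 1")
    case True
    have "?t k \<le> (\<Sum>m=k..n-1. mu m) - (\<Sum>m=k+1..k. ?s m) - (\<Sum>m=k+1..M. ?t m)"
      using range(2)[OF k True] B_bound_le[of k k M mu L n] k by force
    then show ?thesis using sum_pop_front[of k M ?t] k by simp
  next
    case False
    have "(\<Sum>m=k..M. ?t m) = 0" using zero False by (intro sum.neutral) auto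
    then show ?thesis using mu0 k by (auto intro!: sum_nonneg)
  qed
  have "(\<Sum>m=1..M. ?s m) - (\<Sum>m=1+1..M. ?t m) - mu n \<le> ?t 1"
    using range(1)[of 1] M n unfolding A_bound_def by auto
  then have "(\<Sum>m=1..n. mu m) - mu n \<le> (\<Sum>m=1..M. ?t m)"
    using sum_pop_front[of 1 M ?t] M good(5) by simp
  moreover have "(\<Sum>m=1..n. mu m) = (\<Sum>m=1..n-1. mu m) + mu n"
    using n sum.nat_ivl_Suc'[of 1 "n-1" mu] by simp
  ultimately have "(\<Sum>m=1..M. ?t m) = (\<Sum>m=1..n-1. mu m)" using tail[of 1] M by simp
  then show "good_row M mu (n-1) ?t"
    using anti nn zero tail by (auto simp: good_row_def)
qed

text \<open>The second lower bound holds because interlacing bounds the first \<open>k - 1\<close> entries of row \<open>n - 1\<close> by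
  those of row \<open>n\<close> while the totals differ by \<open>\<mu>\<^sub>n\<close>. For the upper bound of index \<open>l\<close>, interlacing replaces
  \<open>\<lambda>\<^bsub>n;l+1\<^esub>, \<dots>, \<lambda>\<^bsub>n;k\<^esub>\<close> by the larger \<open>\<lambda>\<^bsub>n-1;l\<^esub>, \<dots>, \<lambda>\<^bsub>n-1;k-1\<^esub>\<close>, which leaves the tail from \<open>l\<close> of row \<open>n - 1\<close>.\<close>

lemma interlacing_row_is_choice:
  assumes row: "good_row M mu n (L n)" and row': "good_row M mu (n-1) (L (n-1))"
    and ilc: "interlaces M (L n) (L (n-1))" and n: "2 \<le> n"
    and k: "k \<in> {1..M}"
  shows "stepA_choice M mu L n k"
proof (cases "k > n - 1")
  case True
  then show ?thesis using good_rowD(3)[OF row'] k by (auto simp: stepA_choice_def)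
next
  case False
  let ?s = "L n" and ?t = "L (n - 1)"
  have il: "pad M ?s (j+1) \<le> ?t j" "?t j \<le> ?s j" if "j \<in> {1..M}" for j
    using ilc that by (auto simp: interlaces_def)
  have mu_n: "(\<Sum>m=1..n. mu m) = (\<Sum>m=1..n-1. mu m) + mu n"
    using n sum.nat_ivl_Suc'[of 1 "n-1" mu] by simp
  have "(\<Sum>m=1..k-1. ?t m) \<le> (\<Sum>m=1..k-1. ?s m)"
    using il(2) k by (intro sum_mono) auto
  moreover have "k - 1 \<le> M" "1 \<le> k" using k by auto
  ultimately have low: "(\<Sum>m=k..M. ?s m) - mu n \<le> (\<Sum>m=k..M. ?t m)"
    using good_rowD(5)[OF row] good_rowD(5)[OF row'] mu_n sum_split_at[of k M ?s]
      sum_split_at[of k M ?t] by simp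
  have high: "(\<Sum>m=l+1..k. ?s m) + (\<Sum>m=k..M. ?t m) \<le> (\<Sum>m=l..n-1. mu m)"
    if l: "l \<in> {1..k}" for l
  proof -
    have "(\<Sum>m=l+1..k. ?s m) = (\<Sum>m=l..k-1. ?s (Suc m))"
      using sum.shift_bounds_cl_Suc_ivl[of ?s l "k-1"] l by (simp del: sum.cl_ivl_Suc)
    also have "\<dots> \<le> (\<Sum>m=l..k-1. ?t m)"
    proof (rule sum_mono)
      fix m assume "m \<in> {l..k-1}"
      then show "?s (Suc m) \<le> ?t m" using il(1)[of m] k l by (cases k) (auto simp: pad_def)
    qed
    finally have "(\<Sum>m=l+1..k. ?s m) + (\<Sum>m=k..M. ?t m) \<le> (\<Sum>m=l..k-1. ?t m) + (\<Sum>m=k..M. ?t m)"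
      by simp
    also have "\<dots> = (\<Sum>m=l..M. ?t m)"
      using sum.ub_add_nat[of l "k-1" ?t "M-(k-1)"] l k by simp
    also have "\<dots> \<le> (\<Sum>m=l..n-1. mu m)"
      using good_rowD(4)[OF row'] l k by auto
    finally show ?thesis .
  qed
  have "A_bound M mu L n k \<le> ?t k"
    using il(1)[OF k] low sum_pop_front[of k M ?t] k unfolding A_bound_def by auto
  moreover have "?t k \<le> B_bound M mu L n k"
    unfolding B_bound_def
  proof (intro min.boundedI Min.boundedI, goal_cases)
    case (4 a) then show ?case using high sum_pop_front[of k M ?t] k by force
  qed (use il(2)[OF k] k in auto)
  ultimately show ?thesis using False by (auto simp: stepA_choice_def)
qed

lemma good_row_iff_majorizes:
  assumes M: "1 \<le> M" "M \<le> N"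
    and lam: "\<forall>m\<in>{1..M}. 0 \<le> lam m" "antimono_on {1..M} lam"
    and mu: "\<forall>n\<in>{1..N}. 0 \<le> mu n"
  shows "good_row M mu N lam \<longleftrightarrow> majorizes N (pad M lam) mu"
proof -
  have pre: "(\<Sum>m=1..n. pad M lam m) = (\<Sum>m=1..min n M. lam m)" for n
  proof -
    have "(\<Sum>m=1..n. pad M lam m) = (\<Sum>m=1..min n M. pad M lam m)"
      by (rule sum.mono_neutral_right) (auto simp: pad_def)
    then show ?thesis by (simp add: pad_def)
  qed
  have spl: "(\<Sum>m=1..N. mu m) = (\<Sum>m=1..k-1. mu m) + (\<Sum>m=k..N. mu m)" 
            "(\<Sum>m=1..M. lam m) = (\<Sum>m=1..k-1. lam m) + (\<Sum>m=k..M. lam m)" if "k \<in> {1..M}" for k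
    using sum_split_at[of k N mu] sum_split_at[of k M lam] that M by auto
  show ?thesis
  proof
    assume g: "good_row M mu N lam"
    have tot: "(\<Sum>m=1..M. lam m) = (\<Sum>m=1..N. mu m)" using good_rowD(5)[OF g] .
    have "(\<Sum>m=1..n. mu m) \<le> (\<Sum>m=1..n. pad M lam m)" if n: "n \<in> {1..N-1}" for n
    proof (cases "n < M")
      case True
      then show ?thesis using spl[of "n+1"] good_rowD(4)[OF g, of "n+1"] tot pre[of n] n by auto
    next
      case False
      have "(\<Sum>m=1..n. mu m) \<le> (\<Sum>m=1..N. mu m)"
        using mu n by (intro sum_mono2) auto
      then show ?thesis using False pre[of n] tot by simp
    qed
    then show "majorizes N (pad M lam) mu" using tot pre[of N] M by (auto simp: majorizes_def)
  next
    assume maj: "majorizes N (pad M lam) mu"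
    have tot: "(\<Sum>m=1..M. lam m) = (\<Sum>m=1..N. mu m)"
      using maj pre[of N] M by (auto simp: majorizes_def)
    have "(\<Sum>m=k..M. lam m) \<le> (\<Sum>m=k..N. mu m)" if k: "k \<in> {1..M}" for k
    proof (cases "k = 1")
      case True then show ?thesis using tot by simp
    next
      case False
      then have "k - 1 \<in> {1..N-1}" using k M by auto
      then have "(\<Sum>m=1..k-1. mu m) \<le> (\<Sum>m=1..k-1. pad M lam m)"
        using maj unfolding majorizes_def by blast
      then show ?thesis using spl[OF k] pre[of "k-1"] tot k by (simp add: min_def split: if_splits)
    qed
    then show "good_row M mu N lam" using lam tot M by (auto simp: good_row_def)
  qed
qed

lemma good_row_cong:
  assumes "\<And>m. m \<in> {1..M} \<Longrightarrow> s m = s' m" "good_row M mu n s"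
  shows "good_row M mu n s'"
proof -
  have "(\<Sum>m=k..M. s m) = (\<Sum>m=k..M. s' m)" if "k \<in> {1..M}" for k
    using assms(1) that by (intro sum.cong) auto
  moreover have "(\<Sum>m=1..M. s m) = (\<Sum>m=1..M. s' m)"
    using assms(1) by (intro sum.cong) auto
  moreover have "antimono_on {1..M} s'"
    using assms unfolding good_row_def monotone_on_def by auto
  ultimately show ?thesis using assms unfolding good_row_def by auto
qed

text \<open>Rows are determined from the last one downwards, so the invariant is propagated by induction on
  the distance to row \<open>N\<close>.\<close>

lemma rows_before:
  assumes lam: "good_row M mu N lam" and M: "1 \<le> M"
    and mu0: "\<forall>m\<in>{1..N}. 0 \<le> mu m"
    and bef: "stepA_before M N lam mu L n k" and j: "n \<le> j" "j \<le> N" "1 \<le> n"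
  shows "good_row M mu j (L j)" "j < N \<Longrightarrow> interlaces M (L (Suc j)) (L j)"
proof -
  have ch: "stepA_choice M mu L j' i" if "j' \<in> {2..N}" "i \<in> {1..M}" "j' > n" for j' i
    using bef that by (auto simp: stepA_before_def)
  have g: "good_row M mu (N - d) (L (N - d))" if "d \<le> N - n" for d
    using that
  proof (induction d)
    case 0
    then show ?case using lam bef by (auto simp: stepA_before_def intro: good_row_cong[of M lam])
  next
    case (Suc d)
    have "N - d - 1 = N - Suc d" by simp
    moreover have "good_row M mu (N - d - 1) (L (N - d - 1))"
      by (rule row_of_choices(1)) (use Suc M mu0 ch[of "N-d"] j in auto)
    ultimately show ?case by simp
  qed
  show "good_row M mu j (L j)" using g[of "N - j"] j by simp
  assume "j < N"
  then show "interlaces M (L (Suc j)) (L j)"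
    using row_of_choices(2)[of M mu "Suc j" L] g[of "N - Suc j"] ch[of "Suc j"] M mu0 j by auto
qed

lemma choice_possible_before:
  assumes lam: "good_row M mu N lam"
    and mu: "\<forall>m\<in>{1..N}. 0 \<le> mu m" "antimono_on {1..N} mu"
    and bef: "stepA_before M N lam mu L n k"
    and n: "n \<in> {2..N}" and k: "k \<in> {1..M}" "k \<le> n - 1"
  shows "A_bound M mu L n k \<le> B_bound M mu L n k"
proof (rule choice_possible)
  show "good_row M mu n (L n)" by (rule rows_before(1)[OF lam _ mu(1) bef]) (use n k in auto)
  show "antimono_on {1..n} mu" using mu(2) n by (auto intro: monotone_on_subset)
  show "stepA_choice M mu L n i" if "i \<in> {1..M}" "k < i" for i
    using bef n that by (auto simp: stepA_before_def)
qed (use n mu k in auto)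

text \<open>The locality that allows a single entry to be overwritten without disturbing the choices that
  precede it in the order of Step A.\<close>

lemma stepA_choice_cong:
  assumes "\<And>m. m \<in> {1..M} \<Longrightarrow> L n m = L' n m"
    and "\<And>m. m \<in> {k..M} \<Longrightarrow> L (n-1) m = L' (n-1) m" and k: "k \<in> {1..M}"
  shows "stepA_choice M mu L n k \<longleftrightarrow> stepA_choice M mu L' n k"
proof -
  have 1: "(\<Sum>m=j..j'. L n m) = (\<Sum>m=j..j'. L' n m)" if "1 \<le> j" "j' \<le> M" for j j'
    using assms(1) that by (intro sum.cong) auto
  have 2: "(\<Sum>m=k+1..M. L (n-1) m) = (\<Sum>m=k+1..M. L' (n-1) m)"
    using assms(2) k by (intro sum.cong) auto
  have "A_bound M mu L n k = A_bound M mu L' n k"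
    using 1[of k M] 2 k assms(1)[of "k+1"] by (auto simp: A_bound_def pad_def)
  moreover have "B_bound M mu L n k = B_bound M mu L' n k"
    unfolding B_bound_def using 2 k assms(1)[of k] 1[of _ k]
    by (intro arg_cong2[of _ _ _ _ min] arg_cong[of _ _ Min] image_cong) auto
  ultimately show ?thesis using assms(2)[of k] k by (auto simp: stepA_choice_def)
qed

lemma stepA_before_step:
  assumes lam: "good_row M mu N lam"
    and mu: "\<forall>m\<in>{1..N}. 0 \<le> mu m" "antimono_on {1..N} mu"
    and bef: "stepA_before M N lam mu L n k"
    and n: "n \<in> {2..N}" and k: "k \<in> {1..M}"
  shows "\<exists>L'. stepA_before M N lam mu L' n (k - 1)"
proof -
  define x where "x = (if k > n - 1 then 0 else A_bound M mu L n k)"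
  define L' where "L' = L(n - 1 := (L (n - 1))(k := x))"
  have same: "L' j m = L j m" if "j \<noteq> n - 1 \<or> m \<noteq> k" for j m
    using that by (auto simp: L'_def)
  have "A_bound M mu L' n k = A_bound M mu L n k" "B_bound M mu L' n k = B_bound M mu L n k"
    using n by (auto simp: A_bound_def B_bound_def L'_def)
  then have new: "stepA_choice M mu L' n k"
    using choice_possible_before[OF lam mu bef n k]
    by (auto simp: stepA_choice_def L'_def x_def)
  have "stepA_choice M mu L' j i"
    if j: "j \<in> {2..N}" "i \<in> {1..M}" "j > n \<or> j = n \<and> i > k - 1" for j i
  proof (cases "j = n \<and> i = k")
    case True
    then show ?thesis using new by simp
  next
    case False
    then have "j > n \<or> j = n \<and> i > k" using j by auto
    then have "stepA_choice M mu L j i" using bef j by (auto simp: stepA_before_def)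
    moreover have "stepA_choice M mu L j i \<longleftrightarrow> stepA_choice M mu L' j i"
    proof (rule stepA_choice_cong)
      show "L j m = L' j m" for m
        using j n by (intro same[symmetric]) auto
      show "L (j - 1) m = L' (j - 1) m" if "m \<in> {i..M}" for m
        using \<open>j > n \<or> j = n \<and> i > k\<close> that n by (intro same[symmetric]) auto
    qed (use j in auto)
    ultimately show ?thesis by simp
  qed
  moreover have "L' N m = L N m" for m
    using n by (intro same) auto
  then have "\<forall>m\<in>{1..M}. L' N m = lam m"
    using bef by (auto simp: stepA_before_def)
  ultimately show ?thesis unfolding stepA_before_def by blast
qed

text \<open>A table is filled in by repeated single steps: the state \<open>(n, 0)\<close>, in which row \<open>n - 1\<close> is complete,
  is the state \<open>(n - 1, M)\<close>.\<close>

lemma stepA_exists: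
  assumes lam: "good_row M mu N lam"
    and mu: "\<forall>m\<in>{1..N}. 0 \<le> mu m" "antimono_on {1..N} mu"
  shows "\<exists>L. stepA M N lam mu L"
proof -
  have row: "\<exists>L. stepA_before M N lam mu L n 0"
    if "\<exists>L. stepA_before M N lam mu L n M" "n \<in> {2..N}" for n
  proof -
    have "\<exists>L. stepA_before M N lam mu L n (M - d)" if "d \<le> M" for d
      using \<open>d \<le> M\<close>
    proof (induction d)
      case (Suc d)
      then obtain L where "stepA_before M N lam mu L n (M - d)" by auto
      from stepA_before_step[OF lam mu this \<open>n \<in> {2..N}\<close>] Suc.prems
      have "\<exists>L. stepA_before M N lam mu L n (M - d - 1)" by auto
      then show ?case by simp
    qed (use \<open>\<exists>L. stepA_before M N lam mu L n M\<close> in simp)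
    from this[of M] show ?thesis by simp
  qed
  have all: "\<exists>L. stepA_before M N lam mu L (N - d) M" if "d \<le> N - 1" for d
    using that
  proof (induction d)
    case 0
    have "stepA_before M N lam mu (\<lambda>_. lam) N M" by (auto simp: stepA_before_def)
    then show ?case by auto
  next
    case (Suc d)
    then have "N - d \<in> {2..N}" by auto
    then obtain L where L: "stepA_before M N lam mu L (N - d) 0"
      using row[of "N - d"] Suc by auto
    moreover have "j > N - Suc d \<longleftrightarrow> j > N - d \<or> j = N - d" for j
      using Suc.prems by auto
    ultimately have "stepA_before M N lam mu L (N - Suc d) M"
      unfolding stepA_before_def by auto
    then show ?case by auto
  qed
  obtain L where "stepA_before M N lam mu L (N - (N-1)) M" using all[of "N-1"] by auto
  then have "stepA M N lam mu L" unfolding stepA_before_def stepA_def by auto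
  then show ?thesis by blast
qed

definition eigensteps ::
  "nat \<Rightarrow> nat \<Rightarrow> (nat \<Rightarrow> real) \<Rightarrow> (nat \<Rightarrow> nat \<Rightarrow> real) \<Rightarrow> bool" where
  "eigensteps M N mu L \<longleftrightarrow>
     (\<forall>n\<in>{1..N}. good_row M mu n (L n)) \<and> (\<forall>n\<in>{1..<N}. interlaces M (L (Suc n)) (L n))"

lemma stepA_iff_eigensteps:
  assumes M: "1 \<le> M" "1 \<le> N" and lam: "good_row M mu N lam"
    and mu: "\<forall>m\<in>{1..N}. 0 \<le> mu m"
  shows "stepA M N lam mu L \<longleftrightarrow> eigensteps M N mu L \<and> (\<forall>m\<in>{1..M}. L N m = lam m)"
proof
  assume L: "stepA M N lam mu L"
  then have b: "stepA_before M N lam mu L 1 0" by (auto simp: stepA_def stepA_before_def)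
  from rows_before[OF lam M(1) mu b] L
  show "eigensteps M N mu L \<and> (\<forall>m\<in>{1..M}. L N m = lam m)"
    by (auto simp: eigensteps_def stepA_def)
next
  assume "eigensteps M N mu L \<and> (\<forall>m\<in>{1..M}. L N m = lam m)"
  then have e: "eigensteps M N mu L" "\<forall>m\<in>{1..M}. L N m = lam m" by auto
  have "stepA_choice M mu L n k" if n: "n \<in> {2..N}" "k \<in> {1..M}" for n k
  proof (rule interlacing_row_is_choice)
    have "n - 1 \<in> {1..<N}" using n by auto
    then have "interlaces M (L (Suc (n-1))) (L (n-1))"
      using e unfolding eigensteps_def by blast
    then show "interlaces M (L n) (L (n-1))" using n by simp
    have "n - 1 \<in> {1..N}" using n by auto
    then show "good_row M mu (n-1) (L (n-1))" using e unfolding eigensteps_def by blast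
  qed (use e n mu in \<open>auto simp: eigensteps_def\<close>)
  then show "stepA M N lam mu L" using e by (auto simp: stepA_def)
qed

section \<open>Inner products and self-adjoint matrices\<close>

lemma cscalar_prod_sum:
  assumes "w \<in> carrier_vec M"
  shows "v \<bullet>c w = (\<Sum>j<M. v $ j * cnj (w $ j))"
  using assms by (auto simp: scalar_prod_def atLeast0LessThan)

lemma cscalar_prod_commute:
  assumes "v \<in> carrier_vec M" "w \<in> carrier_vec M"
  shows "w \<bullet>c v = cnj (v \<bullet>c w)"
  using assms by (simp add: cscalar_prod_sum[of _ M] mult.commute)

lemma cscalar_prod_self:
  assumes "v \<in> carrier_vec M"
  shows "v \<bullet>c v = of_real (\<Sum>j<M. (cmod (v $ j))\<^sup>2)"
  using assms by (simp add: cscalar_prod_sum[of _ M] complex_norm_square[symmetric] of_real_sum)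

lemma vnorm_sq:
  assumes "v \<in> carrier_vec M"
  shows "(vnorm v)\<^sup>2 = (\<Sum>j<M. (cmod (v $ j))\<^sup>2)" "v \<bullet>c v = of_real ((vnorm v)\<^sup>2)"
  using cscalar_prod_self[OF assms] by (auto simp: vnorm_def sum_nonneg)

lemma vnorm_eq_0_iff:
  assumes "v \<in> carrier_vec M"
  shows "(vnorm v)\<^sup>2 = 0 \<longleftrightarrow> v = 0\<^sub>v M"
  using vnorm_sq(2)[OF assms] conjugate_square_eq_0_vec[OF assms] by simp

lemma mult_mat_vec_sum:
  assumes "A \<in> carrier_mat M M" "x \<in> carrier_vec M" "i < M"
  shows "(A *\<^sub>v x) $ i = (\<Sum>j<M. A $$ (i,j) * x $ j)"
  using assms by (auto simp: scalar_prod_def atLeast0LessThan)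

lemma cscalar_prod_linear:
  assumes "w \<in> carrier_vec M" "v \<in> carrier_vec M" "v' \<in> carrier_vec M"
  shows "(v + v') \<bullet>c w = v \<bullet>c w + v' \<bullet>c w" "(v - v') \<bullet>c w = v \<bullet>c w - v' \<bullet>c w"
    "(c \<cdot>\<^sub>v v) \<bullet>c w = c * (v \<bullet>c w)"
proof -
  have w: "conjugate w \<in> carrier_vec M" using assms by auto
  show "(v + v') \<bullet>c w = v \<bullet>c w + v' \<bullet>c w" using add_scalar_prod_distrib[OF assms(2,3) w] .
  show "(v - v') \<bullet>c w = v \<bullet>c w - v' \<bullet>c w" using minus_scalar_prod_distrib[OF assms(2,3) w] .
  show "(c \<cdot>\<^sub>v v) \<bullet>c w = c * (v \<bullet>c w)" using smult_scalar_prod_distrib[OF assms(2) w] .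
qed

text \<open>The conjugate stands on the left-hand side so that the equation terminates as a rewrite rule.\<close>

definition self_adjoint :: "nat \<Rightarrow> complex mat \<Rightarrow> bool" where
  "self_adjoint M A \<longleftrightarrow> A \<in> carrier_mat M M \<and> (\<forall>i<M. \<forall>j<M. cnj (A $$ (j,i)) = A $$ (i,j))"

lemma self_adjoint_cscalar_prod:
  assumes A: "self_adjoint M A" and x: "x \<in> carrier_vec M" and y: "y \<in> carrier_vec M"
  shows "(A *\<^sub>v x) \<bullet>c y = x \<bullet>c (A *\<^sub>v y)"
proof -
  have A': "A \<in> carrier_mat M M" and h: "\<And>i j. i < M \<Longrightarrow> j < M \<Longrightarrow> cnj (A $$ (j,i)) = A $$ (i,j)"
    using A by (auto simp: self_adjoint_def)
  have "(A *\<^sub>v x) \<bullet>c y = (\<Sum>i<M. (\<Sum>j<M. A $$ (i,j) * x $ j) * cnj (y $ i))"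
    unfolding cscalar_prod_sum[OF y]
    by (rule sum.cong) (use mult_mat_vec_sum[OF A' x] in auto)
  also have "\<dots> = (\<Sum>i<M. \<Sum>j<M. cnj (A $$ (j,i)) * x $ j * cnj (y $ i))"
    unfolding sum_distrib_right using h by (intro sum.cong refl) auto
  also have "\<dots> = (\<Sum>j<M. \<Sum>i<M. cnj (A $$ (j,i)) * x $ j * cnj (y $ i))"
    by (rule sum.swap)
  also have "\<dots> = (\<Sum>j<M. x $ j * cnj (\<Sum>i<M. A $$ (j,i) * y $ i))"
    by (simp add: sum_distrib_left mult_ac)
  also have "\<dots> = (\<Sum>j<M. x $ j * cnj ((A *\<^sub>v y) $ j))"
    by (rule sum.cong) (use mult_mat_vec_sum[OF A' y] in auto)
  also have "\<dots> = x \<bullet>c (A *\<^sub>v y)"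
    using A' y by (subst cscalar_prod_sum[of _ M]) auto
  finally show ?thesis .
qed

section \<open>The trace\<close>

definition mtrace :: "complex mat \<Rightarrow> complex" where
  "mtrace A = (\<Sum>i<dim_row A. A $$ (i,i))"

lemma mtrace_mult_commute:
  assumes "A \<in> carrier_mat n n" "B \<in> carrier_mat n n"
  shows "mtrace (A * B) = mtrace (B * A)"
proof -
  have "mtrace (A * B) = (\<Sum>i<n. \<Sum>k<n. A $$ (i,k) * B $$ (k,i))"
    using assms by (auto simp: mtrace_def scalar_prod_def atLeast0LessThan)
  also have "\<dots> = (\<Sum>k<n. \<Sum>i<n. B $$ (k,i) * A $$ (i,k))"
    by (subst sum.swap) (simp add: mult.commute)
  also have "\<dots> = mtrace (B * A)"
    using assms by (auto simp: mtrace_def scalar_prod_def atLeast0LessThan)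
  finally show ?thesis .
qed

text \<open>A Schur decomposition is a similarity with an upper triangular matrix that has the eigenvalues on
  its diagonal, and similar matrices have equal traces.\<close>

lemma mtrace_eq_sum_list_eigenvalues:
  assumes A: "A \<in> carrier_mat n n" and cp: "char_poly A = (\<Prod>e\<leftarrow>es. [:- e, 1:])"
  shows "mtrace A = sum_list es"
proof -
  obtain B P Q where s: "schur_decomposition A es = (B, P, Q)"
    by (cases "schur_decomposition A es") auto
  have w: "similar_mat_wit A B P Q" "diag_mat B = es"
    using schur_decomposition[OF A cp s] by auto
  note d = similar_mat_witD2[OF A w(1)]
  have "mtrace A = mtrace (P * (B * Q))" using d by (simp add: assoc_mult_mat[of _ n n _ n _ n])
  also have "\<dots> = mtrace ((B * Q) * P)" using d by (intro mtrace_mult_commute) auto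
  also have "(B * Q) * P = B" using d by (simp add: assoc_mult_mat[of _ n n _ n _ n])
  also have "mtrace B = sum_list es"
    using d unfolding w(2)[symmetric] mtrace_def diag_mat_def
    by (simp add: interv_sum_list_conv_sum_set_nat atLeast0LessThan)
  finally show ?thesis .
qed

section \<open>Orthonormal eigenbases\<close>

text \<open>A partial system of \<open>k\<close> eigenvectors, so that a basis can be built one vector at a time.\<close>

definition orthonormal_eigenvectors ::
  "nat \<Rightarrow> complex mat \<Rightarrow> nat \<Rightarrow> (nat \<Rightarrow> real) \<Rightarrow> (nat \<Rightarrow> complex vec) \<Rightarrow> bool" where
  "orthonormal_eigenvectors M A k s u \<longleftrightarrow>
     (\<forall>i\<in>{1..k}. u i \<in> carrier_vec M \<and> A *\<^sub>v u i = complex_of_real (s i) \<cdot>\<^sub>v u i) \<and>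
     (\<forall>i\<in>{1..k}. \<forall>j\<in>{1..k}. u i \<bullet>c u j = (if i = j then 1 else 0))"

lemma orthonormal_eigenvectorsD:
  assumes "orthonormal_eigenvectors M A k s u"
  shows "i \<in> {1..k} \<Longrightarrow> u i \<in> carrier_vec M"
    and "i \<in> {1..k} \<Longrightarrow> A *\<^sub>v u i = complex_of_real (s i) \<cdot>\<^sub>v u i"
    and "i \<in> {1..k} \<Longrightarrow> j \<in> {1..k} \<Longrightarrow> u i \<bullet>c u j = (if i = j then 1 else 0)"
  using assms by (auto simp: orthonormal_eigenvectors_def)

text \<open>Perturb \<open>A\<close> to \<open>C = A + \<i> P\<close>, where \<open>P\<close> is the orthogonal projection to the span of the given
  eigenvectors. The imaginary part of the trace of \<open>C\<close> is \<open>k < M\<close>, so \<open>C\<close> has an eigenvalue \<open>e\<close> whose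
  imaginary part is not 1. Pairing an eigenvector \<open>y\<close> for \<open>e\<close> with \<open>u\<^sub>m\<close> gives
  \<open>(e - s\<^sub>m - \<i>) \<langle>y, u\<^sub>m\<rangle> = 0\<close>, hence \<open>y\<close> is orthogonal to all \<open>u\<^sub>m\<close> and is already an eigenvector of \<open>A\<close>.\<close>

lemma self_adjoint_eigenvector_orthogonal:
  assumes A: "self_adjoint M A" and u: "orthonormal_eigenvectors M A k s u" and k: "k < M"
  shows "\<exists>v x. v \<in> carrier_vec M \<and> A *\<^sub>v v = complex_of_real x \<cdot>\<^sub>v v \<and> v \<bullet>c v = 1 \<and>
    (\<forall>i\<in>{1..k}. v \<bullet>c u i = 0)"
proof -
  note uD = orthonormal_eigenvectorsD[OF u]
  have A': "A \<in> carrier_mat M M" and h: "\<And>i j. i < M \<Longrightarrow> j < M \<Longrightarrow> cnj (A $$ (j,i)) = A $$ (i,j)"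
    using A by (auto simp: self_adjoint_def)
  define C where "C = mat M M (\<lambda>(i,j). A $$ (i,j) + \<i> * (\<Sum>l\<in>{1..k}. u l $ i * cnj (u l $ j)))"
  have C: "C \<in> carrier_mat M M" by (simp add: C_def)
  have Cx: "(C *\<^sub>v x) $ i = (A *\<^sub>v x) $ i + \<i> * (\<Sum>l\<in>{1..k}. (x \<bullet>c u l) * u l $ i)"
    if x: "x \<in> carrier_vec M" and i: "i < M" for x i
  proof -
    have "(\<Sum>j<M. (\<Sum>l\<in>{1..k}. u l $ i * cnj (u l $ j)) * x $ j)
        = (\<Sum>l\<in>{1..k}. \<Sum>j<M. u l $ i * cnj (u l $ j) * x $ j)"
      unfolding sum_distrib_right by (rule sum.swap)
    also have "\<dots> = (\<Sum>l\<in>{1..k}. (x \<bullet>c u l) * u l $ i)"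
      using uD(1) by (intro sum.cong refl) (simp add: cscalar_prod_sum[of _ M] sum_distrib_left mult_ac)
    finally show ?thesis
      using mult_mat_vec_sum[OF C x i] mult_mat_vec_sum[OF A' x i] i
      by (simp add: C_def algebra_simps sum.distrib sum_distrib_left[symmetric])
  qed
  have "mtrace C = mtrace A + \<i> * (\<Sum>i<M. \<Sum>l\<in>{1..k}. u l $ i * cnj (u l $ i))"
    using C A' by (simp add: mtrace_def C_def sum.distrib sum_distrib_left)
  also have "(\<Sum>i<M. \<Sum>l\<in>{1..k}. u l $ i * cnj (u l $ i)) = (\<Sum>l\<in>{1..k}. u l \<bullet>c u l)"
    using uD(1) by (subst sum.swap, intro sum.cong refl) (simp add: cscalar_prod_sum[of _ M])
  also have "\<dots> = of_nat k" using uD(3) by simp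
  finally have trC: "Im (mtrace C) = Im (mtrace A) + k" by simp
  have "Im (A $$ (i,i)) = 0" if "i < M" for i
    using h[OF that that] by (metis Reals_cnj_iff complex_is_Real_iff)
  then have trA: "Im (mtrace A) = 0" using A' by (simp add: mtrace_def)
  obtain es where es: "char_poly C = (\<Prod>e\<leftarrow>es. [:- e, 1:])" "length es = M"
    using char_poly_factorized[OF C] by auto
  have "\<exists>e\<in>set es. Im e \<noteq> 1"
  proof (rule ccontr)
    assume "\<not> ?thesis"
    then have "Im (sum_list es) = of_nat (length es)"
      by (induction es) auto
    then show False
      using mtrace_eq_sum_list_eigenvalues[OF C es(1)] trC trA es(2) k by simp
  qed
  then obtain e where e: "e \<in> set es" "Im e \<noteq> 1" by auto
  have "poly (char_poly C) e = 0"
    unfolding es(1) poly_prod_list using e(1) by (auto simp: prod_list_zero_iff)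
  then obtain y where y: "y \<in> carrier_vec M" "y \<noteq> 0\<^sub>v M" and ye: "C *\<^sub>v y = e \<cdot>\<^sub>v y"
    using eigenvalue_root_char_poly[OF C, of e] C unfolding eigenvalue_def eigenvector_def by auto
  have Ay: "A *\<^sub>v y \<in> carrier_vec M" using A' y by auto
  have orth: "y \<bullet>c u m = 0" if m: "m \<in> {1..k}" for m
  proof -
    have "e * (y \<bullet>c u m) = (C *\<^sub>v y) \<bullet>c u m"
      using cscalar_prod_linear(3)[OF uD(1)[OF m] y(1) y(1)] ye by simp
    also have "\<dots> = (\<Sum>i<M. ((A *\<^sub>v y) $ i + \<i> * (\<Sum>l\<in>{1..k}. (y \<bullet>c u l) * u l $ i)) * cnj (u m $ i))"
      unfolding cscalar_prod_sum[OF uD(1)[OF m]] using Cx[OF y(1)] by (intro sum.cong refl) auto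
    also have "\<dots> = (A *\<^sub>v y) \<bullet>c u m + \<i> * (\<Sum>l\<in>{1..k}. (y \<bullet>c u l) * (u l \<bullet>c u m))"
    proof -
      have "(\<Sum>i<M. (\<Sum>l\<in>{1..k}. (y \<bullet>c u l) * u l $ i) * cnj (u m $ i))
        = (\<Sum>l\<in>{1..k}. \<Sum>i<M. (y \<bullet>c u l) * u l $ i * cnj (u m $ i))"
        unfolding sum_distrib_right by (rule sum.swap)
      also have "\<dots> = (\<Sum>l\<in>{1..k}. (y \<bullet>c u l) * (u l \<bullet>c u m))"
        unfolding cscalar_prod_sum[OF uD(1)[OF m]] by (simp add: sum_distrib_left mult_ac)
      finally show ?thesis
        unfolding cscalar_prod_sum[OF uD(1)[OF m]]
        by (simp add: distrib_right sum.distrib sum_distrib_left[symmetric] mult.assoc)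
    qed
    also have "(\<Sum>l\<in>{1..k}. (y \<bullet>c u l) * (u l \<bullet>c u m)) = (\<Sum>l\<in>{1..k}. if l = m then y \<bullet>c u l else 0)"
      using uD(3) m by (intro sum.cong refl) auto
    also have "\<dots> = y \<bullet>c u m" using m by simp
    also have "(A *\<^sub>v y) \<bullet>c u m = y \<bullet>c (of_real (s m) \<cdot>\<^sub>v u m)"
      using self_adjoint_cscalar_prod[OF A y(1) uD(1)[OF m]] uD(2)[OF m] by simp
    also have "\<dots> = of_real (s m) * (y \<bullet>c u m)"
      using uD(1)[OF m] y by (simp add: cscalar_prod_sum[of _ M] sum_distrib_left mult_ac)
    finally have "(e - of_real (s m) - \<i>) * (y \<bullet>c u m) = 0" by (simp add: algebra_simps)
    moreover have "e - of_real (s m) - \<i> \<noteq> 0" using e(2) by (auto simp: complex_eq_iff)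
    ultimately show ?thesis by simp
  qed
  have Ay_eq: "A *\<^sub>v y = e \<cdot>\<^sub>v y"
  proof (rule eq_vecI)
    fix i assume "i < dim_vec (e \<cdot>\<^sub>v y)"
    then have i: "i < M" using y by simp
    have "(C *\<^sub>v y) $ i = (A *\<^sub>v y) $ i" using Cx[OF y(1) i] orth by simp
    then show "(A *\<^sub>v y) $ i = (e \<cdot>\<^sub>v y) $ i" using ye by simp
  qed (use A' y in auto)
  have ny: "(vnorm y)\<^sup>2 \<noteq> 0" using vnorm_eq_0_iff[OF y(1)] y(2) by simp
  have "e * (y \<bullet>c y) = cnj e * (y \<bullet>c y)"
  proof -
    have "e * (y \<bullet>c y) = (A *\<^sub>v y) \<bullet>c y"
      using Ay_eq cscalar_prod_linear(3)[OF y(1) y(1) y(1)] by simp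
    also have "\<dots> = y \<bullet>c (e \<cdot>\<^sub>v y)" using self_adjoint_cscalar_prod[OF A y(1) y(1)] Ay_eq by simp
    also have "\<dots> = cnj e * (y \<bullet>c y)"
      using y by (simp add: cscalar_prod_sum[of _ M] sum_distrib_left mult_ac)
    finally show ?thesis .
  qed
  then have "e = cnj e" using vnorm_sq(2)[OF y(1)] ny by simp
  then have e_real: "e = of_real (Re e)" by (simp add: complex_eq_iff)
  define c :: complex where "c = of_real (1 / vnorm y)"
  define v where "v = c \<cdot>\<^sub>v y"
  have v: "v \<in> carrier_vec M" using y by (simp add: v_def)
  moreover have "A *\<^sub>v v = complex_of_real (Re e) \<cdot>\<^sub>v v"
    unfolding v_def mult_mat_vec[OF A' y(1)] Ay_eq
    by (subst e_real) (simp add: smult_smult_assoc mult.commute)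
  moreover have "v \<bullet>c v = 1"
  proof -
    have "v \<bullet>c v = c * cnj c * (y \<bullet>c y)"
      unfolding v_def using y by (simp add: cscalar_prod_sum[of _ M] sum_distrib_left mult_ac)
    also have "\<dots> = 1" using ny unfolding vnorm_sq(2)[OF y(1)] c_def
      by (simp add: power2_eq_square)
    finally show ?thesis .
  qed
  moreover have "\<forall>i\<in>{1..k}. v \<bullet>c u i = 0"
    using cscalar_prod_linear(3)[OF uD(1) y(1) y(1)] orth by (simp add: v_def)
  ultimately show ?thesis by blast
qed

abbreviation eigenbasis :: "nat \<Rightarrow> complex mat \<Rightarrow> (nat \<Rightarrow> real) \<Rightarrow> (nat \<Rightarrow> complex vec) \<Rightarrow> bool" where
  "eigenbasis M A s u \<equiv> orthonormal_eigenvectors M A M s u"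

lemma self_adjoint_eigenbasis:
  assumes A: "self_adjoint M A"
  shows "\<exists>s u. eigenbasis M A s u"
proof -
  have "\<exists>s u. orthonormal_eigenvectors M A k s u" if "k \<le> M" for k
    using that
  proof (induction k)
    case 0
    have "orthonormal_eigenvectors M A 0 s u" for s u
      by (simp add: orthonormal_eigenvectors_def)
    then show ?case by blast
  next
    case (Suc k)
    then obtain s u where u: "orthonormal_eigenvectors M A k s u" by auto
    from self_adjoint_eigenvector_orthogonal[OF A u] Suc.prems
    obtain v x where v: "v \<in> carrier_vec M" "A *\<^sub>v v = complex_of_real x \<cdot>\<^sub>v v" "v \<bullet>c v = 1"
      "\<forall>i\<in>{1..k}. v \<bullet>c u i = 0" by auto
    have v': "u i \<bullet>c v = 0" if "i \<in> {1..k}" for i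
      using v cscalar_prod_commute[OF v(1) orthonormal_eigenvectorsD(1)[OF u that]] that by simp
    have "orthonormal_eigenvectors M A (Suc k) (s(Suc k := x)) (u(Suc k := v))"
      using u v v' unfolding orthonormal_eigenvectors_def
      by (auto simp: le_Suc_eq)
    then show ?case by blast
  qed
  from this[of M] show ?thesis by simp
qed

section \<open>Coordinates with respect to an orthonormal basis\<close>

text \<open>A left inverse of a square matrix is a right inverse: orthonormality of the columns is
  orthonormality of the rows.\<close>

lemma eigenbasis_complete:
  assumes u: "eigenbasis M A s u" and ij: "i < M" "j < M"
  shows "(\<Sum>k\<in>{1..M}. u k $ i * cnj (u k $ j)) = (if i = j then 1 else 0)"
proof -
  note uD = orthonormal_eigenvectorsD[OF u]
  define U where "U = mat M M (\<lambda>(i,j). u (Suc j) $ i)"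
  define V where "V = mat M M (\<lambda>(i,j). cnj (u (Suc i) $ j))"
  have UV: "U \<in> carrier_mat M M" "V \<in> carrier_mat M M" by (auto simp: U_def V_def)
  have "V * U = 1\<^sub>m M"
  proof (rule eq_matI)
    fix a b assume "a < dim_row (1\<^sub>m M :: complex mat)" "b < dim_col (1\<^sub>m M :: complex mat)"
    then have ab: "a < M" "b < M" by auto
    have "(V * U) $$ (a, b) = (\<Sum>k<M. cnj (u (Suc a) $ k) * u (Suc b) $ k)"
      using ab UV by (simp add: scalar_prod_def atLeast0LessThan U_def V_def)
    also have "\<dots> = u (Suc b) \<bullet>c u (Suc a)"
      using ab uD(1)[of "Suc a"] by (subst cscalar_prod_sum[of _ M]) (auto simp: mult.commute)
    also have "\<dots> = 1\<^sub>m M $$ (a, b)" using uD(3)[of "Suc b" "Suc a"] ab by auto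
    finally show "(V * U) $$ (a, b) = 1\<^sub>m M $$ (a, b)" .
  qed (use UV in auto)
  then have "U * V = 1\<^sub>m M" using mat_mult_left_right_inverse UV by blast
  then have "(U * V) $$ (i, j) = (if i = j then 1 else 0)" using ij by simp
  moreover have "(U * V) $$ (i, j) = (\<Sum>k<M. u (Suc k) $ i * cnj (u (Suc k) $ j))"
    using ij UV by (simp add: scalar_prod_def atLeast0LessThan U_def V_def)
  moreover have "\<dots> = (\<Sum>k\<in>{1..M}. u k $ i * cnj (u k $ j))"
    by (simp add: sum.atLeast1_atMost_eq)
  ultimately show ?thesis by simp
qed

lemma parseval:
  assumes u: "eigenbasis M A s u" and v: "v \<in> carrier_vec M" and w: "w \<in> carrier_vec M"
  shows "v \<bullet>c w = (\<Sum>k\<in>{1..M}. (v \<bullet>c u k) * cnj (w \<bullet>c u k))"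
proof -
  note uD = orthonormal_eigenvectorsD[OF u]
  have "(\<Sum>k\<in>{1..M}. (v \<bullet>c u k) * cnj (w \<bullet>c u k))
    = (\<Sum>k\<in>{1..M}. \<Sum>i<M. \<Sum>j<M. v $ i * cnj (w $ j) * (cnj (u k $ i) * u k $ j))"
    using uD(1) by (intro sum.cong refl)
      (simp add: cscalar_prod_sum[of _ M] sum_product mult_ac)
  also have "\<dots> = (\<Sum>i<M. \<Sum>j<M. \<Sum>k\<in>{1..M}. v $ i * cnj (w $ j) * (cnj (u k $ i) * u k $ j))"
    by (subst sum.swap, rule sum.cong[OF refl], rule sum.swap)
  also have "\<dots> = (\<Sum>i<M. \<Sum>j<M. if j = i then v $ i * cnj (w $ j) else 0)"
    using eigenbasis_complete[OF u]
    by (intro sum.cong refl) (simp add: sum_distrib_left[symmetric] mult.commute)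
  also have "\<dots> = (\<Sum>i<M. v $ i * cnj (w $ i))"
    by (intro sum.cong refl) simp
  also have "\<dots> = v \<bullet>c w" using cscalar_prod_sum[OF w] by simp
  finally show ?thesis by simp
qed

lemma vnorm_sq_coords:
  assumes u: "eigenbasis M A s u" and v: "v \<in> carrier_vec M"
  shows "(vnorm v)\<^sup>2 = (\<Sum>k\<in>{1..M}. (cmod (v \<bullet>c u k))\<^sup>2)"
proof -
  have "complex_of_real ((vnorm v)\<^sup>2) = of_real (\<Sum>k\<in>{1..M}. (cmod (v \<bullet>c u k))\<^sup>2)"
    using parseval[OF u v v] vnorm_sq(2)[OF v]
    by (simp add: complex_norm_square[symmetric])
  then show ?thesis using of_real_eq_iff by blast
qed

lemma coords_eqI:
  assumes u: "eigenbasis M A s u" and v: "v \<in> carrier_vec M" and w: "w \<in> carrier_vec M"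
    and eq: "\<And>k. k \<in> {1..M} \<Longrightarrow> v \<bullet>c u k = w \<bullet>c u k"
  shows "v = w"
proof -
  note uD = orthonormal_eigenvectorsD[OF u]
  have "(vnorm (v - w))\<^sup>2 = 0"
    using vnorm_sq_coords[OF u, of "v - w"] v w eq cscalar_prod_linear(2)[OF uD(1) v w]
    by auto
  then have "v - w = 0\<^sub>v M" using vnorm_eq_0_iff[of "v - w" M] v w by auto
  then have "(v - w) $ i = 0" if "i < M" for i using that by simp
  then show ?thesis using v w by (intro eq_vecI) auto
qed

lemma coords_exist:
  assumes u: "eigenbasis M A s u"
  shows "\<exists>v\<in>carrier_vec M. \<forall>k\<in>{1..M}. v \<bullet>c u k = c k"
proof -
  note uD = orthonormal_eigenvectorsD[OF u]
  define v where "v = vec M (\<lambda>j. \<Sum>i\<in>{1..M}. c i * u i $ j)"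
  have "v \<bullet>c u k = c k" if k: "k \<in> {1..M}" for k
  proof -
    have "v \<bullet>c u k = (\<Sum>j<M. \<Sum>i\<in>{1..M}. c i * u i $ j * cnj (u k $ j))"
      using uD(1)[OF k] by (simp add: cscalar_prod_sum[of _ M] v_def sum_distrib_right)
    also have "\<dots> = (\<Sum>i\<in>{1..M}. c i * (u i \<bullet>c u k))"
      using uD(1)[OF k]
      by (subst sum.swap) (simp add: cscalar_prod_sum[of _ M] sum_distrib_left mult_ac)
    also have "\<dots> = (\<Sum>i\<in>{1..M}. if i = k then c i else 0)"
      using uD(3) k by (intro sum.cong refl) auto
    also have "\<dots> = c k" using k by simp
    finally show ?thesis .
  qed
  then show ?thesis by (intro bexI[of _ v]) (auto simp: v_def)
qed

lemma coords_mult_mat_vec: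
  assumes A: "self_adjoint M A" and u: "eigenbasis M A s u" and v: "v \<in> carrier_vec M"
    and k: "k \<in> {1..M}"
  shows "(A *\<^sub>v v) \<bullet>c u k = of_real (s k) * (v \<bullet>c u k)"
proof -
  note uD = orthonormal_eigenvectorsD[OF u]
  have "(A *\<^sub>v v) \<bullet>c u k = v \<bullet>c (of_real (s k) \<cdot>\<^sub>v u k)"
    using self_adjoint_cscalar_prod[OF A v uD(1)[OF k]] uD(2)[OF k] by simp
  also have "\<dots> = of_real (s k) * (v \<bullet>c u k)"
    using uD(1)[OF k] v by (simp add: cscalar_prod_sum[of _ M] sum_distrib_left mult_ac)
  finally show ?thesis .
qed

text \<open>The matrix on the right is \<open>U\<^sup>* B U\<close>, where the unitary matrix \<open>U\<close> has the basis vectors as columns.\<close>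

lemma char_poly_in_eigenbasis:
  assumes u: "eigenbasis M A s u" and B: "B \<in> carrier_mat M M"
  shows "char_poly B = char_poly (mat M M (\<lambda>(i,j). (B *\<^sub>v u (Suc j)) \<bullet>c u (Suc i)))"
proof -
  note uD = orthonormal_eigenvectorsD[OF u]
  define U where "U = mat M M (\<lambda>(i,j). u (Suc j) $ i)"
  define V where "V = mat M M (\<lambda>(i,j). cnj (u (Suc i) $ j))"
  let ?X = "mat M M (\<lambda>(i,j). (B *\<^sub>v u (Suc j)) \<bullet>c u (Suc i))"
  have UV: "U \<in> carrier_mat M M" "V \<in> carrier_mat M M" by (auto simp: U_def V_def)
  have "U * V = 1\<^sub>m M"
  proof (rule eq_matI)
    fix a b assume "a < dim_row (1\<^sub>m M :: complex mat)" "b < dim_col (1\<^sub>m M :: complex mat)"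
    then have ab: "a < M" "b < M" by auto
    have "(U * V) $$ (a, b) = (\<Sum>k<M. u (Suc k) $ a * cnj (u (Suc k) $ b))"
      using ab UV by (simp add: scalar_prod_def atLeast0LessThan U_def V_def)
    also have "\<dots> = (\<Sum>k\<in>{1..M}. u k $ a * cnj (u k $ b))"
      by (simp add: sum.atLeast1_atMost_eq)
    finally show "(U * V) $$ (a, b) = 1\<^sub>m M $$ (a, b)"
      using eigenbasis_complete[OF u ab] ab by simp
  qed (use UV in auto)
  moreover from this have VU: "V * U = 1\<^sub>m M" using mat_mult_left_right_inverse UV by blast
  moreover have X: "?X = V * (B * U)"
  proof (rule eq_matI)
    fix a b assume "a < dim_row (V * (B * U))" "b < dim_col (V * (B * U))"
    then have ab: "a < M" "b < M" using UV by auto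
    have "col U b = u (Suc b)"
      using ab uD(1)[of "Suc b"] by (intro eq_vecI) (auto simp: U_def)
    then have BU: "col (B * U) b = B *\<^sub>v u (Suc b)" using col_mult2[OF B UV(1) ab(2)] by simp
    have "(V * (B * U)) $$ (a, b) = row V a \<bullet> col (B * U) b"
      using ab UV B by simp
    also have "\<dots> = (\<Sum>k<M. cnj (u (Suc a) $ k) * (B *\<^sub>v u (Suc b)) $ k)"
      unfolding BU using ab UV B by (simp add: scalar_prod_def atLeast0LessThan V_def)
    also have "\<dots> = (B *\<^sub>v u (Suc b)) \<bullet>c u (Suc a)"
      using ab uD(1)[of "Suc a"] by (subst cscalar_prod_sum[of _ M]) (auto simp: mult.commute)
    finally show "?X $$ (a, b) = (V * (B * U)) $$ (a, b)" using ab by simp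
  qed (use UV in auto)
  have "U * ?X * V = (U * V) * B * (U * V)"
    unfolding X using UV B by (simp add: assoc_mult_mat[of _ M M _ M _ M])
  then have "B = U * ?X * V" using calculation(1) B by simp
  then have "similar_mat B ?X"
    using UV B calculation(1) VU by (intro similar_matI[of _ _ U V M]) auto
  then show ?thesis by (rule char_poly_similar)
qed

section \<open>Spectra of self-adjoint matrices\<close>

lemma char_poly_eigenbasis:
  assumes A: "self_adjoint M A" and u: "eigenbasis M A s u"
  shows "char_poly A = (\<Prod>m=1..M. [:- complex_of_real (s m), 1:])"
proof -
  note uD = orthonormal_eigenvectorsD[OF u]
  have A': "A \<in> carrier_mat M M" using A by (simp add: self_adjoint_def)
  let ?D = "mat M M (\<lambda>(i,j). if i = j then complex_of_real (s (Suc i)) else 0)"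
  have "mat M M (\<lambda>(i,j). (A *\<^sub>v u (Suc j)) \<bullet>c u (Suc i)) = ?D"
  proof (rule eq_matI)
    fix i j assume "i < dim_row ?D" "j < dim_col ?D"
    then have ij: "i < M" "j < M" by auto
    then show "mat M M (\<lambda>(i,j). (A *\<^sub>v u (Suc j)) \<bullet>c u (Suc i)) $$ (i,j) = ?D $$ (i,j)"
      using coords_mult_mat_vec[OF A u uD(1)[of "Suc j"], of "Suc i"] uD(3)[of "Suc j" "Suc i"] by auto
  qed auto
  then have "char_poly A = char_poly ?D" using char_poly_in_eigenbasis[OF u A'] by simp
  also have "\<dots> = (\<Prod>a\<leftarrow>diag_mat ?D. [:- a, 1:])"
    by (rule char_poly_upper_triangular[of _ M]) auto
  also have "diag_mat ?D = map (\<lambda>i. complex_of_real (s (Suc i))) [0..<M]"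
    by (auto simp: diag_mat_def)
  also have "(\<Prod>a\<leftarrow>\<dots>. [:- a, 1:]) = (\<Prod>i<M. [:- complex_of_real (s (Suc i)), 1:])"
    using prod.distinct_set_conv_list[of "[0..<M]" "\<lambda>i. [:- complex_of_real (s (Suc i)), 1:]"]
    by (simp add: o_def atLeast0LessThan)
  also have "\<dots> = (\<Prod>m=1..M. [:- complex_of_real (s m), 1:])"
    by (simp add: prod.atLeast1_atMost_eq)
  finally show ?thesis .
qed

lemma eigenbasis_reindex:
  assumes u: "eigenbasis M A s u" and eq: "image_mset r (mset_set {1..M}) = image_mset s (mset_set {1..M})"
  shows "\<exists>u'. eigenbasis M A r u'"
proof -
  obtain p where p: "p permutes {1..M}" "\<forall>x\<in>{1..M}. r x = s (p x)"
    by (rule image_mset_eq_implies_permutes[OF _ eq]) auto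
  have "p i \<in> {1..M}" if "i \<in> {1..M}" for i using permutes_in_image[OF p(1)] that by blast
  moreover have "p i = p j \<longleftrightarrow> i = j" for i j using permutes_inj[OF p(1)] by (auto dest: injD)
  ultimately have "eigenbasis M A r (u \<circ> p)"
    using u p(2) unfolding orthonormal_eigenvectors_def by auto
  then show ?thesis by blast
qed

lemma prod_linear_factors_eq_imp:
  fixes r s :: "nat \<Rightarrow> complex"
  assumes "(\<Prod>m=1..M. [:- r m, 1:]) = (\<Prod>m=1..M. [:- s m, 1:])"
  shows "image_mset r (mset_set {1..M}) = image_mset s (mset_set {1..M})"
proof -
  have "proots (\<Prod>m=1..M. [:- r m, 1:]) = image_mset r (mset_set {1..M})" for r :: "nat \<Rightarrow> complex"
    by (subst proots_prod) (auto simp: sum_unfold_sum_mset)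
  then show ?thesis using assms by metis
qed

text \<open>The roots of the characteristic polynomial, with multiplicity, are the eigenvalues of any
  eigenbasis; permuting its vectors brings them into the order of \<open>s\<close>.\<close>

lemma has_spectrum_eigenbasis:
  assumes A: "self_adjoint M A" and s: "has_spectrum M A s"
  shows "\<exists>u. eigenbasis M A s u"
proof -
  obtain s0 u0 where u0: "eigenbasis M A s0 u0" using self_adjoint_eigenbasis[OF A] by auto
  have "image_mset (complex_of_real \<circ> s) (mset_set {1..M}) = image_mset (complex_of_real \<circ> s0) (mset_set {1..M})"
    by (rule prod_linear_factors_eq_imp)
      (use s char_poly_eigenbasis[OF A u0] in \<open>auto simp: has_spectrum_def\<close>)
  then have "image_mset Re (image_mset (complex_of_real \<circ> s) (mset_set {1..M}))
     = image_mset Re (image_mset (complex_of_real \<circ> s0) (mset_set {1..M}))" by simp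
  then show ?thesis by (intro eigenbasis_reindex[OF u0]) (simp add: multiset.map_comp o_def)
qed

text \<open>Some eigenbasis exists; sorting its eigenvalues in nonincreasing order permutes its vectors.\<close>

lemma self_adjoint_has_spectrum:
  assumes A: "self_adjoint M A"
  shows "\<exists>s. has_spectrum M A s"
proof -
  obtain s0 u0 where u0: "eigenbasis M A s0 u0" using self_adjoint_eigenbasis[OF A] by auto
  define xs where "xs = rev (sort (map s0 [1..<Suc M]))"
  define s where "s i = xs ! (i - 1)" for i
  have len: "length xs = M" by (simp add: xs_def)
  have "image_mset s (mset_set {1..M}) = mset (map s [1..<Suc M])"
    by (simp add: atLeastLessThanSuc_atLeastAtMost del: upt_Suc)
  also have "map s [1..<Suc M] = xs"
    using len by (intro nth_equalityI) (auto simp: s_def simp del: upt_Suc)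
  also have "mset xs = mset (map s0 [1..<Suc M])" by (simp add: xs_def del: upt_Suc)
  also have "\<dots> = image_mset s0 (mset_set {1..M})"
    by (simp add: atLeastLessThanSuc_atLeastAtMost del: upt_Suc)
  finally obtain u where u: "eigenbasis M A s u" using eigenbasis_reindex[OF u0] by auto
  have "sorted (rev xs)" by (simp add: xs_def)
  have "s j \<le> s i" if "i \<in> {1..M}" "j \<in> {1..M}" "i \<le> j" for i j
    unfolding s_def using sorted_rev_nth_mono[OF \<open>sorted (rev xs)\<close>, of "i - 1" "j - 1"] that len by auto
  then have "has_spectrum M A s"
    using char_poly_eigenbasis[OF A u] by (auto simp: has_spectrum_def intro!: monotone_onI)
  then show ?thesis by blast
qed

section \<open>Rank-one perturbations\<close>

definition rank_one :: "nat \<Rightarrow> complex vec \<Rightarrow> complex mat" where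
  "rank_one M v = mat M M (\<lambda>(i,j). v $ i * cnj (v $ j))"

lemma rank_one_carrier [simp]: "rank_one M v \<in> carrier_mat M M"
    "dim_row (rank_one M v) = M" "dim_col (rank_one M v) = M"
  by (simp_all add: rank_one_def)

lemma self_adjoint_add_rank_one:
  assumes "self_adjoint M A"
  shows "self_adjoint M (A + rank_one M v)"
  using assms by (auto simp: self_adjoint_def rank_one_def)

lemma add_rank_one_mult_vec:
  assumes A: "A \<in> carrier_mat M M" and v: "v \<in> carrier_vec M" and x: "x \<in> carrier_vec M"
  shows "(A + rank_one M v) *\<^sub>v x = A *\<^sub>v x + (x \<bullet>c v) \<cdot>\<^sub>v v"
proof (rule eq_vecI)
  fix i assume "i < dim_vec (A *\<^sub>v x + (x \<bullet>c v) \<cdot>\<^sub>v v)"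
  then have i: "i < M" using v by simp
  have "((A + rank_one M v) *\<^sub>v x) $ i = (\<Sum>j<M. (A + rank_one M v) $$ (i,j) * x $ j)"
    using A x i by (intro mult_mat_vec_sum) auto
  also have "\<dots> = (\<Sum>j<M. A $$ (i,j) * x $ j) + (\<Sum>j<M. x $ j * cnj (v $ j)) * v $ i"
    using A i unfolding sum_distrib_right sum.distrib[symmetric]
    by (intro sum.cong refl) (simp add: rank_one_def algebra_simps)
  also have "\<dots> = (A *\<^sub>v x + (x \<bullet>c v) \<cdot>\<^sub>v v) $ i"
    using mult_mat_vec_sum[OF A x i] cscalar_prod_sum[OF v, of x] v i by simp
  finally show "((A + rank_one M v) *\<^sub>v x) $ i = (A *\<^sub>v x + (x \<bullet>c v) \<cdot>\<^sub>v v) $ i" .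
qed (use A v in auto)

lemma add_rank_one_form:
  assumes A: "A \<in> carrier_mat M M" and v: "v \<in> carrier_vec M" and x: "x \<in> carrier_vec M"
    and y: "y \<in> carrier_vec M"
  shows "((A + rank_one M v) *\<^sub>v x) \<bullet>c y = (A *\<^sub>v x) \<bullet>c y + (x \<bullet>c v) * (v \<bullet>c y)"
  unfolding add_rank_one_mult_vec[OF A v x]
  using A x v y cscalar_prod_linear(1)[OF y, of "A *\<^sub>v x" "(x \<bullet>c v) \<cdot>\<^sub>v v"]
    cscalar_prod_linear(3)[OF y v v] by simp

text \<open>The matrix determinant lemma. Both sides are the determinant of the bordered matrix with blocks
  \<open>1\<close>, \<open>b\<close>, \<open>a\<close>, \<open>D\<close>, once after clearing the column below the corner by row operations (\<open>P\<close>), once after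
  clearing it by column operations (\<open>Q\<close>).\<close>

lemma det_diag_minus_rank_one:
  fixes d a b :: "nat \<Rightarrow> complex"
  assumes d: "\<And>i. i < n \<Longrightarrow> d i \<noteq> 0"
  shows "det (mat n n (\<lambda>(i,j). (if i = j then d i else 0) - a i * b j))
    = (\<Prod>i<n. d i) * (1 - (\<Sum>i<n. a i * b i / d i))"
proof -
  let ?X = "mat n n (\<lambda>(i,j). (if i = j then d i else 0) - a i * b j)"
  define D where "D = mat n n (\<lambda>(i,j). if i = j then d i else 0)"
  define ca where "ca = mat n 1 (\<lambda>(i,j). a i)"
  define rb where "rb = mat 1 n (\<lambda>(i,j). b j)"
  define cad where "cad = mat n 1 (\<lambda>(i,j). - a i / d i)"
  define E where "E = four_block_mat (1\<^sub>m 1) rb ca D"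
  define P where "P = four_block_mat (1\<^sub>m 1) (0\<^sub>m 1 n) (- ca) (1\<^sub>m n :: complex mat)"
  define Q where "Q = four_block_mat (1\<^sub>m 1) (0\<^sub>m 1 n) cad (1\<^sub>m n :: complex mat)"
  define e where "e = 1 - (\<Sum>i<n. a i * b i / d i)"
  have c: "D \<in> carrier_mat n n" "ca \<in> carrier_mat n 1" "rb \<in> carrier_mat 1 n" "cad \<in> carrier_mat n 1"
    by (auto simp: D_def ca_def rb_def cad_def)
  have cE: "E \<in> carrier_mat (1 + n) (1 + n)" "P \<in> carrier_mat (1 + n) (1 + n)" "Q \<in> carrier_mat (1 + n) (1 + n)"
    unfolding E_def P_def Q_def using c by (auto intro!: four_block_carrier_mat)
  have detPQ: "det P = 1" "det Q = 1"
    unfolding P_def Q_def using c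
    by (subst det_four_block_mat_upper_right_zero[of _ 1 _ n], auto)+
  have "P * E = four_block_mat (1\<^sub>m 1 * 1\<^sub>m 1 + 0\<^sub>m 1 n * ca) (1\<^sub>m 1 * rb + 0\<^sub>m 1 n * D)
      (- ca * 1\<^sub>m 1 + 1\<^sub>m n * ca) (- ca * rb + 1\<^sub>m n * D)"
    unfolding P_def E_def using c by (intro mult_four_block_mat) auto
  also have "1\<^sub>m 1 * 1\<^sub>m 1 + 0\<^sub>m 1 n * ca = 1\<^sub>m 1" using c by simp
  also have "- ca * 1\<^sub>m 1 + 1\<^sub>m n * ca = 0\<^sub>m n 1"
    using c by (auto intro!: eq_matI)
  also have "- ca * rb + 1\<^sub>m n * D = ?X"
    using c by (intro eq_matI) (auto simp: ca_def rb_def D_def scalar_prod_def)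
  finally have PE_block: "P * E = four_block_mat (1\<^sub>m 1) (1\<^sub>m 1 * rb + 0\<^sub>m 1 n * D) (0\<^sub>m n 1) ?X" .
  have PE: "det (P * E) = det ?X"
    unfolding PE_block using c by (subst det_four_block_mat_lower_left_zero_col[of _ _ n]) auto
  have "E * Q = four_block_mat (1\<^sub>m 1 * 1\<^sub>m 1 + rb * cad) (1\<^sub>m 1 * 0\<^sub>m 1 n + rb * 1\<^sub>m n)
      (ca * 1\<^sub>m 1 + D * cad) (ca * 0\<^sub>m 1 n + D * 1\<^sub>m n)"
    unfolding Q_def E_def using c by (intro mult_four_block_mat) auto
  also have "1\<^sub>m 1 * 1\<^sub>m 1 + rb * cad = mat 1 1 (\<lambda>_. e)"
  proof (rule eq_matI)
    fix i j assume "i < dim_row (mat 1 1 (\<lambda>_. e))" "j < dim_col (mat 1 1 (\<lambda>_. e))"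
    then have "i = 0" "j = 0" by auto
    moreover have "(rb * cad) $$ (0,0) = - (\<Sum>i<n. a i * b i / d i)"
      using c by (simp add: scalar_prod_def rb_def cad_def atLeast0LessThan sum_negf mult.commute)
    ultimately show "(1\<^sub>m 1 * 1\<^sub>m 1 + rb * cad) $$ (i,j) = mat 1 1 (\<lambda>_. e) $$ (i,j)"
      using c by (simp add: e_def)
  qed (use c in auto)
  also have "ca * 1\<^sub>m 1 + D * cad = 0\<^sub>m n 1"
  proof (rule eq_matI)
    fix i j assume "i < dim_row (0\<^sub>m n 1 :: complex mat)" "j < dim_col (0\<^sub>m n 1 :: complex mat)"
    then have ij: "i < n" "j = 0" by auto
    have "(D * cad) $$ (i,0) = (\<Sum>k<n. (if i = k then d i else 0) * (- a k / d k))"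
      using c ij by (simp add: scalar_prod_def D_def cad_def atLeast0LessThan)
    also have "\<dots> = (\<Sum>k<n. (if k = i then - a i else 0))"
      using d ij by (intro sum.cong refl) auto
    finally have "(D * cad) $$ (i,0) = (\<Sum>k<n. (if k = i then - a i else 0))" .
    then show "(ca * 1\<^sub>m 1 + D * cad) $$ (i,j) = 0\<^sub>m n 1 $$ (i,j)"
      using c ij by (simp add: ca_def)
  qed (use c in auto)
  also have "ca * 0\<^sub>m 1 n + D * 1\<^sub>m n = D" using c by simp
  finally have EQ_block: "E * Q = four_block_mat (mat 1 1 (\<lambda>_. e)) (1\<^sub>m 1 * 0\<^sub>m 1 n + rb * 1\<^sub>m n) (0\<^sub>m n 1) D" .
  have "det (E * Q) = det (mat 1 1 (\<lambda>_. e)) * det D"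
    unfolding EQ_block using c by (subst det_four_block_mat_lower_left_zero_col[of _ _ n]) auto
  also have "det (mat 1 1 (\<lambda>_. e)) = e" by (subst det_single) auto
  also have "det D = prod_list (diag_mat D)"
    using c by (intro det_upper_triangular[of _ n]) (auto simp: D_def)
  also have "\<dots> = (\<Prod>i<n. d i)"
  proof -
    have "diag_mat D = map d [0..<n]" by (auto simp: diag_mat_def D_def)
    then show ?thesis using prod.distinct_set_conv_list[of "[0..<n]" d] by (simp add: atLeast0LessThan)
  qed
  finally have "det (E * Q) = (\<Prod>i<n. d i) * e" by simp
  moreover have "det (E * Q) = det E" "det (P * E) = det E"
    using det_mult[OF cE(1,3)] det_mult[OF cE(2,1)] detPQ by auto
  ultimately show ?thesis using PE by (simp add: e_def)
qed

text \<open>In the eigenbasis, \<open>A + v v\<^sup>*\<close> becomes a diagonal matrix plus a rank-one matrix.\<close>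

lemma char_poly_add_rank_one:
  assumes A: "self_adjoint M A" and u: "eigenbasis M A s u" and v: "v \<in> carrier_vec M"
    and x: "\<And>i. i \<in> {1..M} \<Longrightarrow> x \<noteq> complex_of_real (s i)"
  shows "poly (char_poly (A + rank_one M v)) x
    = (\<Prod>i\<in>{1..M}. x - of_real (s i)) * (1 - (\<Sum>i\<in>{1..M}. of_real ((cmod (v \<bullet>c u i))\<^sup>2) / (x - of_real (s i))))"
proof -
  note uD = orthonormal_eigenvectorsD[OF u]
  have A': "A \<in> carrier_mat M M" using A by (simp add: self_adjoint_def)
  let ?B = "A + rank_one M v"
  have B: "?B \<in> carrier_mat M M" using A' by simp
  let ?X = "mat M M (\<lambda>(i,j). (?B *\<^sub>v u (Suc j)) \<bullet>c u (Suc i))"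
  let ?w = "\<lambda>i. v \<bullet>c u (Suc i)"
  let ?Y = "mat M M (\<lambda>(i,j). (if i = j then x - of_real (s (Suc i)) else 0) - ?w i * cnj (?w j))"
  have entry: "(?B *\<^sub>v u (Suc j)) \<bullet>c u (Suc i) = (if i = j then of_real (s (Suc i)) else 0) + ?w i * cnj (?w j)"
    if ij: "i < M" "j < M" for i j
    using add_rank_one_form[OF A' v uD(1)[of "Suc j"] uD(1)[of "Suc i"]] ij
      coords_mult_mat_vec[OF A u uD(1)[of "Suc j"], of "Suc i"] uD(3)[of "Suc j" "Suc i"]
      cscalar_prod_commute[OF v uD(1)[of "Suc j"]]
    by auto
  have "poly (char_poly ?B) x = poly (char_poly ?X) x"
    using char_poly_in_eigenbasis[OF u B] by simp
  also have "\<dots> = det (- char_matrix ?X x)"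
    by (rule char_poly_matrix[of _ M]) simp
  also have "- char_matrix ?X x = ?Y"
    by (rule eq_matI) (auto simp: char_matrix_def entry)
  also have "det ?Y = (\<Prod>i<M. x - of_real (s (Suc i))) *
      (1 - (\<Sum>i<M. ?w i * cnj (?w i) / (x - of_real (s (Suc i)))))"
    using x by (intro det_diag_minus_rank_one) auto
  also have "\<dots> = (\<Prod>i\<in>{1..M}. x - of_real (s i)) * (1 - (\<Sum>i\<in>{1..M}. of_real ((cmod (v \<bullet>c u i))\<^sup>2) / (x - of_real (s i))))"
    by (simp add: prod.atLeast1_atMost_eq sum.atLeast1_atMost_eq complex_norm_square[symmetric])
  finally show ?thesis .
qed

lemma poly_spec_poly: "poly (spec_poly M s) t = (\<Prod>m=1..M. t - s m)"
  by (simp add: spec_poly_def poly_prod)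

lemma spec_poly_ratio:
  assumes A: "self_adjoint M A" and u: "eigenbasis M A s u" and v: "v \<in> carrier_vec M"
    and r: "has_spectrum M (A + rank_one M v) r"
    and t: "t \<notin> s ` {1..M}"
  shows "poly (spec_poly M r) t / poly (spec_poly M s) t
    = 1 - (\<Sum>i\<in>{1..M}. (cmod (v \<bullet>c u i))\<^sup>2 / (t - s i))"
proof -
  have "complex_of_real (\<Prod>m=1..M. t - r m) = poly (char_poly (A + rank_one M v)) (of_real t)"
    using r by (simp add: has_spectrum_def poly_prod)
  also have "\<dots> = of_real ((\<Prod>m=1..M. t - s m) * (1 - (\<Sum>i\<in>{1..M}. (cmod (v \<bullet>c u i))\<^sup>2 / (t - s i))))"
    using t by (subst char_poly_add_rank_one[OF A u v]) auto
  finally have "(\<Prod>m=1..M. t - r m) = (\<Prod>m=1..M. t - s m) * (1 - (\<Sum>i\<in>{1..M}. (cmod (v \<bullet>c u i))\<^sup>2 / (t - s i)))"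
    using of_real_eq_iff by blast
  moreover have "(\<Prod>m=1..M. t - s m) \<noteq> 0" using t by auto
  ultimately show ?thesis unfolding poly_spec_poly by (simp add: field_simps)
qed

text \<open>Only the summands with a pole at \<open>x\<close> survive the factor \<open>t - x\<close>.\<close>

lemma residue_of_simple_fractions:
  fixes s c :: "nat \<Rightarrow> real"
  shows "((\<lambda>t. (t - x) * (1 - (\<Sum>i\<in>{1..M}. c i / (t - s i)))) \<longlongrightarrow>
     - (\<Sum>i | i \<in> {1..M} \<and> s i = x. c i)) (at x)"
proof -
  have frac: "((\<lambda>t. (t - x) * (c i / (t - s i))) \<longlongrightarrow> (if s i = x then c i else 0)) (at x)" for i
  proof (cases "s i = x")
    case True
    have "\<forall>\<^sub>F t in at x. c i = (t - x) * (c i / (t - s i))"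
      using True by (auto simp: eventually_at_filter)
    then show ?thesis using True tendsto_cong[of "\<lambda>_. c i"] by fastforce
  next
    case False
    have "((\<lambda>t. (t - x) * (c i / (t - s i))) \<longlongrightarrow> (x - x) * (c i / (x - s i))) (at x)"
      using False by (intro tendsto_intros) auto
    then show ?thesis using False by simp
  qed
  have "((\<lambda>t. (t - x) - (\<Sum>i\<in>{1..M}. (t - x) * (c i / (t - s i)))) \<longlongrightarrow>
     (x - x) - (\<Sum>i\<in>{1..M}. if s i = x then c i else 0)) (at x)"
    by (intro tendsto_intros frac)
  moreover have "(\<Sum>i\<in>{1..M}. if s i = x then c i else 0) = (\<Sum>i | i \<in> {1..M} \<and> s i = x. c i)"
    by (rule sum.inter_filter[symmetric]) simp
  moreover have "(t - x) * (1 - (\<Sum>i\<in>{1..M}. c i / (t - s i)))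
      = (t - x) - (\<Sum>i\<in>{1..M}. (t - x) * (c i / (t - s i)))" for t
    by (simp only: right_diff_distrib sum_distrib_left mult_1_right)
  ultimately show ?thesis by (simp only: diff_self diff_0)
qed

text \<open>The eigenspace consists of the vectors whose coordinates vanish outside the indices with
  eigenvalue \<open>x\<close>; projecting to it deletes all other coordinates.\<close>

lemma orth_proj_eigenspace:
  assumes A: "self_adjoint M A" and u: "eigenbasis M A s u" and v: "v \<in> carrier_vec M"
  shows "(vnorm (orth_proj (eigenspace M A (of_real x)) v))\<^sup>2
    = (\<Sum>i | i \<in> {1..M} \<and> s i = x. (cmod (v \<bullet>c u i))\<^sup>2)"
proof -
  note uD = orthonormal_eigenvectorsD[OF u]
  have A': "A \<in> carrier_mat M M" using A by (simp add: self_adjoint_def)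
  let ?W = "eigenspace M A (of_real x)"
  have W: "y \<in> ?W \<longleftrightarrow> y \<in> carrier_vec M \<and> (\<forall>i\<in>{1..M}. s i \<noteq> x \<longrightarrow> y \<bullet>c u i = 0)" for y
  proof -
    have "y \<in> ?W \<longleftrightarrow> y \<in> carrier_vec M \<and> A *\<^sub>v y = of_real x \<cdot>\<^sub>v y"
    proof -
      let ?K = "complex_of_real x \<cdot>\<^sub>m 1\<^sub>m M - A"
      have K: "?K \<in> carrier_mat M M" using A' by auto
      have Ky: "?K *\<^sub>v y = of_real x \<cdot>\<^sub>v y - A *\<^sub>v y" if y: "y \<in> carrier_vec M"
      proof -
        have "?K *\<^sub>v y = (of_real x \<cdot>\<^sub>m 1\<^sub>m M) *\<^sub>v y - A *\<^sub>v y"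
          using A' y by (intro minus_mult_distrib_mat_vec) auto
        also have "(complex_of_real x \<cdot>\<^sub>m 1\<^sub>m M) *\<^sub>v y = of_real x \<cdot>\<^sub>v y"
          using y by (auto intro!: eq_vecI)
        finally show ?thesis .
      qed
      have zero_iff: "of_real x \<cdot>\<^sub>v y - A *\<^sub>v y = 0\<^sub>v M \<longleftrightarrow> A *\<^sub>v y = of_real x \<cdot>\<^sub>v y" if y: "y \<in> carrier_vec M"
      proof
        assume z: "of_real x \<cdot>\<^sub>v y - A *\<^sub>v y = 0\<^sub>v M"
        show "A *\<^sub>v y = of_real x \<cdot>\<^sub>v y"
        proof (rule eq_vecI)
          fix i assume "i < dim_vec (complex_of_real x \<cdot>\<^sub>v y)"
          then show "(A *\<^sub>v y) $ i = (complex_of_real x \<cdot>\<^sub>v y) $ i"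
            using arg_cong[OF z, of "\<lambda>w. w $ i"] y A' by auto
        qed (use A' y in auto)
      qed (use y in auto)
      have "y \<in> ?W \<longleftrightarrow> y \<in> carrier_vec M \<and> ?K *\<^sub>v y = 0\<^sub>v M"
        unfolding eigenspace_def mat_kernel[OF K] by simp
      then show ?thesis using Ky zero_iff by metis
    qed
    also have "\<dots> \<longleftrightarrow> y \<in> carrier_vec M \<and> (\<forall>i\<in>{1..M}. s i \<noteq> x \<longrightarrow> y \<bullet>c u i = 0)"
    proof (intro conj_cong refl iffI ballI impI)
      fix i assume y: "y \<in> carrier_vec M" and e: "A *\<^sub>v y = of_real x \<cdot>\<^sub>v y"
        and i: "i \<in> {1..M}" "s i \<noteq> x"
      have "of_real (s i) * (y \<bullet>c u i) = of_real x * (y \<bullet>c u i)"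
        using coords_mult_mat_vec[OF A u y i(1)] e cscalar_prod_linear(3)[OF uD(1)[OF i(1)] y y] by auto
      then show "y \<bullet>c u i = 0" using i(2) by simp
    next
      assume y: "y \<in> carrier_vec M" and z: "\<forall>i\<in>{1..M}. s i \<noteq> x \<longrightarrow> y \<bullet>c u i = 0"
      show "A *\<^sub>v y = of_real x \<cdot>\<^sub>v y"
      proof (rule coords_eqI[OF u])
        fix i assume i: "i \<in> {1..M}"
        show "(A *\<^sub>v y) \<bullet>c u i = (of_real x \<cdot>\<^sub>v y) \<bullet>c u i"
          using coords_mult_mat_vec[OF A u y i] cscalar_prod_linear(3)[OF uD(1)[OF i] y y] z i
          by (cases "s i = x") auto
      qed (use A' y in auto)
    qed
    finally show ?thesis .
  qed
  obtain p where p: "p \<in> carrier_vec M"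
    and pc: "\<And>i. i \<in> {1..M} \<Longrightarrow> p \<bullet>c u i = (if s i = x then v \<bullet>c u i else 0)"
    using coords_exist[OF u, of "\<lambda>i. if s i = x then v \<bullet>c u i else 0"] by auto
  have pW: "p \<in> ?W" using W p pc by auto
  have porth: "(v - p) \<bullet>c y = 0" if y: "y \<in> ?W" for y
  proof -
    have y': "y \<in> carrier_vec M" using W y by auto
    have "((v - p) \<bullet>c u i) * cnj (y \<bullet>c u i) = 0" if i: "i \<in> {1..M}" for i
      using cscalar_prod_linear(2)[OF uD(1)[OF i] v p] pc[OF i] W y i by auto
    then have "(\<Sum>i\<in>{1..M}. ((v - p) \<bullet>c u i) * cnj (y \<bullet>c u i)) = 0" by (intro sum.neutral) blast
    then show ?thesis using parseval[OF u _ y', of "v - p"] v p by simp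
  qed
  have uniq: "w = p" if w: "w \<in> ?W" and orth: "\<forall>y\<in>?W. (v - w) \<bullet>c y = 0" for w
  proof (rule coords_eqI[OF u])
    show wc: "w \<in> carrier_vec M" using W w by auto
    fix i assume i: "i \<in> {1..M}"
    show "w \<bullet>c u i = p \<bullet>c u i"
    proof (cases "s i = x")
      case True
      have "u i \<in> ?W" using W uD(1)[OF i] uD(3) i True by auto
      then have "(v - w) \<bullet>c u i = 0" using orth by blast
      then show ?thesis using cscalar_prod_linear(2)[OF uD(1)[OF i] v wc] pc[OF i] True by simp
    next
      case False
      then show ?thesis using W w i pc[OF i] by auto
    qed
  qed (rule p)
  have "orth_proj ?W v = p"
    unfolding orth_proj_def
  proof (rule the_equality)
    show "p \<in> ?W \<and> (\<forall>y\<in>?W. (v - p) \<bullet>c y = 0)" using pW porth by blast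
    show "w = p" if "w \<in> ?W \<and> (\<forall>y\<in>?W. (v - w) \<bullet>c y = 0)" for w
      using uniq that by blast
  qed
  then have "(vnorm (orth_proj ?W v))\<^sup>2 = (\<Sum>k\<in>{1..M}. (cmod (p \<bullet>c u k))\<^sup>2)"
    by (simp only: vnorm_sq_coords[OF u p])
  also have "\<dots> = (\<Sum>k\<in>{1..M}. if s k = x then (cmod (v \<bullet>c u k))\<^sup>2 else 0)"
    using pc by (intro sum.cong refl) simp
  also have "\<dots> = (\<Sum>i | i \<in> {1..M} \<and> s i = x. (cmod (v \<bullet>c u i))\<^sup>2)"
    by (rule sum.inter_filter[symmetric]) simp
  finally show ?thesis .
qed

text \<open>The coefficients of the simple fractions with pole \<open>x\<close> add up to the squared length of the projection of
  \<open>v\<close>. This is the link between the condition of Step B and the spectrum of the next frame operator.\<close>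

lemma residue_limit:
  assumes A: "self_adjoint M A" and s: "has_spectrum M A s" and v: "v \<in> carrier_vec M"
    and r: "has_spectrum M (A + rank_one M v) r"
  shows "((\<lambda>t. (t - x) * (poly (spec_poly M r) t / poly (spec_poly M s) t)) \<longlongrightarrow>
     - (vnorm (orth_proj (eigenspace M A (of_real x)) v))\<^sup>2) (at x)"
proof -
  obtain u where u: "eigenbasis M A s u" using has_spectrum_eigenbasis[OF A s] by auto
  have "\<forall>\<^sub>F t in at x. t \<notin> s ` {1..M}"
    using islimpt_finite[of "s ` {1..M}" x] by (simp add: islimpt_iff_eventually)
  then have "\<forall>\<^sub>F t in at x. (t - x) * (1 - (\<Sum>i\<in>{1..M}. (cmod (v \<bullet>c u i))\<^sup>2 / (t - s i)))
      = (t - x) * (poly (spec_poly M r) t / poly (spec_poly M s) t)"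
    by eventually_elim (simp add: spec_poly_ratio[OF A u v r])
  from Lim_transform_eventually[OF residue_of_simple_fractions this]
  show ?thesis unfolding orth_proj_eigenspace[OF A u v] .
qed

section \<open>Residues determine a monic polynomial\<close>

text \<open>If \<open>s\<^sub>a\<close> is one of the listed roots, multiplying the quotient by the remaining factors shows
  \<open>d(s\<^sub>a) = 0\<close>. Cancelling \<open>t - s\<^sub>a\<close> from numerator and denominator leaves the same situation with one root
  fewer, so repeated roots need no separate treatment.\<close>

lemma zero_if_residues_vanish:
  fixes d :: "real poly"
  assumes "finite I" "d = 0 \<or> degree d < card I"
    and "\<And>i. i \<in> I \<Longrightarrow> ((\<lambda>t. (t - s i) * (poly d t / (\<Prod>j\<in>I. t - s j))) \<longlongrightarrow> 0) (at (s i))"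
  shows "d = 0"
  using assms
proof (induction I arbitrary: d rule: finite_induct)
  case (insert a I)
  have P: "((\<lambda>t. \<Prod>j\<in>I. t - s j) \<longlongrightarrow> (\<Prod>j\<in>I. x - s j)) (at x)" for x
    by (intro tendsto_intros)
  have ev: "\<forall>\<^sub>F t in at x. t \<notin> s ` insert a I" for x
    using islimpt_finite[of "s ` insert a I" x] insert.hyps(1) by (simp add: islimpt_iff_eventually del: image_insert)
  have "((\<lambda>t. (t - s a) * (poly d t / (\<Prod>j\<in>insert a I. t - s j)) * (\<Prod>j\<in>I. t - s j)) \<longlongrightarrow> 0 * (\<Prod>j\<in>I. s a - s j)) (at (s a))"
    by (intro tendsto_mult insert.prems(2) P) simp
  moreover have "\<forall>\<^sub>F t in at (s a). (t - s a) * (poly d t / (\<Prod>j\<in>insert a I. t - s j)) * (\<Prod>j\<in>I. t - s j) = poly d t"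
    using ev[of "s a"]
  proof eventually_elim
    case (elim t)
    then have "t - s a \<noteq> 0" "(\<Prod>j\<in>I. t - s j) \<noteq> 0" using insert.hyps(1) by auto
    then show ?case using insert.hyps by simp
  qed
  ultimately have "(poly d \<longlongrightarrow> 0) (at (s a))"
    using Lim_transform_eventually by fastforce
  moreover have "(poly d \<longlongrightarrow> poly d (s a)) (at (s a))"
    by (rule isContD[OF poly_isCont])
  ultimately have "poly d (s a) = 0" using LIM_unique by blast
  then obtain e where e: "d = [:- s a, 1:] * e" by (auto simp: poly_eq_0_iff_dvd)
  have "e = 0"
  proof (rule insert.IH)
    have "degree d = 1 + degree e" if "e \<noteq> 0"
      unfolding e using that by (subst degree_mult_eq) auto
    moreover have "d \<noteq> 0" if "e \<noteq> 0" unfolding e using that by (subst mult_eq_0_iff) auto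
    ultimately show "e = 0 \<or> degree e < card I"
      using insert.prems(1) insert.hyps(1,2) by (cases "e = 0") auto
    fix i assume i: "i \<in> I"
    have lim: "((\<lambda>t. (t - s i) * (poly d t / (\<Prod>j\<in>insert a I. t - s j))) \<longlongrightarrow> 0) (at (s i))"
      using insert.prems(2) i by blast
    have "\<forall>\<^sub>F t in at (s i). (t - s i) * (poly d t / (\<Prod>j\<in>insert a I. t - s j)) = (t - s i) * (poly e t / (\<Prod>j\<in>I. t - s j))"
      using ev[of "s i"]
    proof eventually_elim
      case (elim t)
      then have "t - s a \<noteq> 0" by auto
      moreover have "poly d t = (t - s a) * poly e t" unfolding e by (simp add: algebra_simps)
      ultimately show ?case using insert.hyps by simp
    qed
    from Lim_transform_eventually[OF lim this]
    show "((\<lambda>t. (t - s i) * (poly e t / (\<Prod>j\<in>I. t - s j))) \<longlongrightarrow> 0) (at (s i))" .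
  qed
  then show ?case using e by simp
qed auto

lemma spec_poly_monic: "monic (spec_poly M s)" "degree (spec_poly M s) = M"
proof -
  show "monic (spec_poly M s)" unfolding spec_poly_def by (rule monic_prod) auto
  show "degree (spec_poly M s) = M" unfolding spec_poly_def by (subst degree_prod_eq_sum_degree) auto
qed

text \<open>The difference of two monic polynomials of degree \<open>M\<close> has degree below \<open>M\<close> and vanishing residues.\<close>

lemma spec_poly_eqI:
  assumes "\<And>x. x \<in> s ` {1..M} \<Longrightarrow>
    ((\<lambda>t. (t - x) * (poly (spec_poly M r) t / poly (spec_poly M s) t)) \<longlongrightarrow> l x) (at x)"
    and "\<And>x. x \<in> s ` {1..M} \<Longrightarrow>
    ((\<lambda>t. (t - x) * (poly (spec_poly M r') t / poly (spec_poly M s) t)) \<longlongrightarrow> l x) (at x)"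
  shows "spec_poly M r = spec_poly M r'"
proof -
  let ?d = "spec_poly M r - spec_poly M r'"
  have "?d = 0"
  proof (rule zero_if_residues_vanish[of "{1..M}"])
    show "?d = 0 \<or> degree ?d < card {1..M}"
    proof (cases "M = 0")
      case False
      have "degree ?d < M"
      proof (rule degree_lessI)
        show "?d \<noteq> 0 \<or> 0 < M" using False by simp
        show "\<forall>k\<ge>M. coeff ?d k = 0"
        proof (intro allI impI)
          fix k assume "M \<le> k"
          then show "coeff ?d k = 0"
            using spec_poly_monic[of M r] spec_poly_monic[of M r']
            by (cases "k = M") (auto simp: coeff_eq_0)
        qed
      qed
      then show ?thesis by simp
    qed (simp add: spec_poly_def)
    fix i assume "i \<in> {1..M}"
    then have "s i \<in> s ` {1..M}" by blast
    from tendsto_diff[OF assms(1)[OF this] assms(2)[OF this]]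
    show "((\<lambda>t. (t - s i) * (poly ?d t / (\<Prod>j\<in>{1..M}. t - s j))) \<longlongrightarrow> 0) (at (s i))"
      by (simp add: poly_spec_poly diff_divide_distrib right_diff_distrib)
  qed simp
  then show ?thesis by simp
qed

lemma has_spectrum_if_spec_poly_eq:
  assumes "has_spectrum M B r" "spec_poly M r = spec_poly M r'" "antimono_on {1..M} r'"
  shows "has_spectrum M B r'"
proof -
  have hom: "map_poly complex_of_real (spec_poly M q) = (\<Prod>m=1..M. [:- complex_of_real (q m), 1:])" for q
  proof -
    interpret map_poly_comm_ring_hom complex_of_real ..
    show ?thesis by (simp add: spec_poly_def hom_prod map_poly_pCons)
  qed
  show ?thesis using assms hom[of r] hom[of r'] by (simp add: has_spectrum_def)
qed

section \<open>Eigenvalue interlacing\<close>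

text \<open>Fewer than \<open>M\<close> linear equations in \<open>M\<close> unknowns: padded with a zero row, the coefficient matrix has
  determinant zero.\<close>

lemma common_orthogonal_vector:
  fixes T :: "complex vec set"
  assumes T: "finite T" "T \<subseteq> carrier_vec M" "card T < M"
  shows "\<exists>x\<in>carrier_vec M. x \<noteq> 0\<^sub>v M \<and> (\<forall>g\<in>T. x \<bullet>c g = 0)"
proof -
  obtain g where g: "bij_betw g {0..<card T} T" using ex_bij_betw_nat_finite[OF T(1)] by auto
  define G where "G = mat M M (\<lambda>(i,j). if i < card T then cnj (g i $ j) else 0)"
  have G: "G \<in> carrier_mat M M" by (simp add: G_def)
  have "G = mat\<^sub>r M M (\<lambda>i. if i = card T then 0\<^sub>v M else row G i)"
    by (rule eq_matI) (auto simp: G_def)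
  also have "det \<dots> = 0" using T(3) G by (intro det_row_0) auto
  finally have "det G = 0" .
  then obtain x where x: "x \<in> carrier_vec M" "x \<noteq> 0\<^sub>v M" "G *\<^sub>v x = 0\<^sub>v M"
    using det_0_iff_vec_prod_zero[OF G] by auto
  have "x \<bullet>c y = 0" if "y \<in> T" for y
  proof -
    obtain i where i: "i < card T" "y = g i"
      using g \<open>y \<in> T\<close> unfolding bij_betw_def by (metis imageE atLeastLessThan_iff)
    have iM: "i < M" using i T(3) by simp
    have "(\<Sum>j<M. G $$ (i,j) * x $ j) = 0"
      using mult_mat_vec_sum[OF G x(1) iM] x(3) iM by simp
    moreover have "x \<bullet>c y = (\<Sum>j<M. G $$ (i,j) * x $ j)"
      using i iM T(2) \<open>y \<in> T\<close> by (subst cscalar_prod_sum[of _ M]) (auto simp: G_def mult.commute)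
    ultimately show ?thesis by simp
  qed
  then show ?thesis using x by blast
qed

lemma quadratic_form_coords:
  assumes A: "self_adjoint M A" and u: "eigenbasis M A s u" and x: "x \<in> carrier_vec M"
  shows "Re ((A *\<^sub>v x) \<bullet>c x) = (\<Sum>i\<in>{1..M}. s i * (cmod (x \<bullet>c u i))\<^sup>2)"
proof -
  have Ax: "A *\<^sub>v x \<in> carrier_vec M" using A x by (auto simp: self_adjoint_def)
  have "(A *\<^sub>v x) \<bullet>c x = (\<Sum>i\<in>{1..M}. of_real (s i * (cmod (x \<bullet>c u i))\<^sup>2))"
    unfolding parseval[OF u Ax x]
    using coords_mult_mat_vec[OF A u x]
    by (intro sum.cong refl) (simp add: complex_norm_square mult.assoc del: of_real_power)
  then show ?thesis by (simp del: of_real_mult of_real_power)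
qed

lemma quadratic_form_bounds:
  assumes A: "self_adjoint M A" and u: "eigenbasis M A s u" and x: "x \<in> carrier_vec M"
  shows "(\<And>i. i \<in> {1..M} \<Longrightarrow> x \<bullet>c u i \<noteq> 0 \<Longrightarrow> c \<le> s i) \<Longrightarrow> c * (vnorm x)\<^sup>2 \<le> Re ((A *\<^sub>v x) \<bullet>c x)"
    and "(\<And>i. i \<in> {1..M} \<Longrightarrow> x \<bullet>c u i \<noteq> 0 \<Longrightarrow> s i \<le> c) \<Longrightarrow> Re ((A *\<^sub>v x) \<bullet>c x) \<le> c * (vnorm x)\<^sup>2"
proof -
  assume c: "\<And>i. i \<in> {1..M} \<Longrightarrow> x \<bullet>c u i \<noteq> 0 \<Longrightarrow> c \<le> s i"
  have "c * (cmod (x \<bullet>c u i))\<^sup>2 \<le> s i * (cmod (x \<bullet>c u i))\<^sup>2" if "i \<in> {1..M}" for i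
    using c[OF that] by (cases "x \<bullet>c u i = 0") (auto intro: mult_right_mono)
  then show "c * (vnorm x)\<^sup>2 \<le> Re ((A *\<^sub>v x) \<bullet>c x)"
    unfolding quadratic_form_coords[OF A u x] vnorm_sq_coords[OF u x] sum_distrib_left
    by (rule sum_mono)
next
  assume c: "\<And>i. i \<in> {1..M} \<Longrightarrow> x \<bullet>c u i \<noteq> 0 \<Longrightarrow> s i \<le> c"
  have "s i * (cmod (x \<bullet>c u i))\<^sup>2 \<le> c * (cmod (x \<bullet>c u i))\<^sup>2" if "i \<in> {1..M}" for i
    using c[OF that] by (cases "x \<bullet>c u i = 0") (auto intro: mult_right_mono)
  then show "Re ((A *\<^sub>v x) \<bullet>c x) \<le> c * (vnorm x)\<^sup>2"
    unfolding quadratic_form_coords[OF A u x] vnorm_sq_coords[OF u x] sum_distrib_left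
    by (rule sum_mono)
qed

text \<open>The Courant-Fischer argument. A nonzero vector \<open>x\<close> that is orthogonal to \<open>T\<close>, to the eigenvectors of \<open>A\<close>
  beyond \<open>i\<close> and to those of \<open>B\<close> before \<open>j\<close> satisfies
  \<open>s\<^sub>i |x|\<^sup>2 \<le> \<langle>A x, x\<rangle> \<le> \<langle>B x, x\<rangle> \<le> r\<^sub>j |x|\<^sup>2\<close>. The set \<open>T\<close> allows the forms to be compared on a subspace only.\<close>

lemma eigenvalue_le_of_forms:
  assumes A: "self_adjoint M A" "has_spectrum M A s" and B: "self_adjoint M B" "has_spectrum M B r"
    and k: "i \<in> {1..M}" "j \<in> {1..M}"
    and T: "finite T" "T \<subseteq> carrier_vec M" "M - i + (j - 1) + card T < M"
    and le: "\<And>x. x \<in> carrier_vec M \<Longrightarrow> (\<forall>g\<in>T. x \<bullet>c g = 0) \<Longrightarrow> Re ((A *\<^sub>v x) \<bullet>c x) \<le> Re ((B *\<^sub>v x) \<bullet>c x)"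
  shows "s i \<le> r j"
proof -
  obtain u where u: "eigenbasis M A s u" using has_spectrum_eigenbasis[OF A] by auto
  obtain w where w: "eigenbasis M B r w" using has_spectrum_eigenbasis[OF B] by auto
  let ?T = "u ` {i+1..M} \<union> (w ` {1..<j} \<union> T)"
  have "card ?T \<le> card (u ` {i+1..M}) + (card (w ` {1..<j}) + card T)"
    by (rule order_trans[OF card_Un_le add_left_mono[OF card_Un_le]])
  also have "\<dots> \<le> (M - i) + ((j - 1) + card T)"
    using card_image_le[of "{i+1..M}" u] card_image_le[of "{1..<j}" w] by simp
  finally have "card ?T < M" using T(3) by simp
  moreover have "?T \<subseteq> carrier_vec M"
    using T(2) orthonormal_eigenvectorsD(1)[OF u] orthonormal_eigenvectorsD(1)[OF w] k by auto
  ultimately obtain x where x: "x \<in> carrier_vec M" "x \<noteq> 0\<^sub>v M" "\<forall>g\<in>?T. x \<bullet>c g = 0"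
    using common_orthogonal_vector[of ?T M] T(1) by auto
  have "s i * (vnorm x)\<^sup>2 \<le> Re ((A *\<^sub>v x) \<bullet>c x)"
  proof (rule quadratic_form_bounds(1)[OF A(1) u x(1)])
    fix l assume l: "l \<in> {1..M}" "x \<bullet>c u l \<noteq> 0"
    have "l \<le> i"
    proof (rule ccontr)
      assume "\<not> l \<le> i"
      then have "u l \<in> ?T" using l(1) by auto
      then show False using x(3) l(2) by blast
    qed
    then show "s i \<le> s l" using A(2) l k antimono_on_atLeastAtMostD by (auto simp: has_spectrum_def)
  qed
  also have "\<dots> \<le> Re ((B *\<^sub>v x) \<bullet>c x)" using le x by auto
  also have "\<dots> \<le> r j * (vnorm x)\<^sup>2"
  proof (rule quadratic_form_bounds(2)[OF B(1) w x(1)])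
    fix l assume l: "l \<in> {1..M}" "x \<bullet>c w l \<noteq> 0"
    have "\<not> l < j"
    proof
      assume "l < j"
      then have "w l \<in> ?T" using l(1) by auto
      then show False using x(3) l(2) by blast
    qed
    then show "r l \<le> r j" using B(2) l k antimono_on_atLeastAtMostD by (auto simp: has_spectrum_def)
  qed
  finally show ?thesis
    using vnorm_eq_0_iff[OF x(1)] x(2) by (simp add: mult_le_cancel_right)
qed

text \<open>The form of \<open>A + v v\<^sup>*\<close> dominates that of \<open>A\<close> everywhere and coincides with it on the orthogonal
  complement of \<open>v\<close>. The second fact costs one dimension, whence the shift of the index.\<close>

lemma interlacing_add_rank_one:
  assumes A: "self_adjoint M A" "has_spectrum M A s" and v: "v \<in> carrier_vec M"
    and r: "has_spectrum M (A + rank_one M v) r" and k: "k \<in> {1..M}"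
  shows "s k \<le> r k" "k + 1 \<le> M \<Longrightarrow> r (k + 1) \<le> s k"
proof -
  let ?B = "A + rank_one M v"
  have A': "A \<in> carrier_mat M M" using A by (simp add: self_adjoint_def)
  have B: "self_adjoint M ?B" by (rule self_adjoint_add_rank_one[OF A(1)])
  have form: "Re ((?B *\<^sub>v x) \<bullet>c x) = Re ((A *\<^sub>v x) \<bullet>c x) + (cmod (x \<bullet>c v))\<^sup>2"
    if x: "x \<in> carrier_vec M" for x
    unfolding add_rank_one_form[OF A' v x x] cscalar_prod_commute[OF x v]
    by (simp add: complex_mult_cnj cmod_power2)
  show "s k \<le> r k"
  proof (rule eigenvalue_le_of_forms[OF A B r k k, of "{}"])
    show "Re ((A *\<^sub>v x) \<bullet>c x) \<le> Re ((?B *\<^sub>v x) \<bullet>c x)" if "x \<in> carrier_vec M" for x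
      unfolding form[OF that] by simp
  qed (use k in auto)
  assume k': "k + 1 \<le> M"
  show "r (k + 1) \<le> s k"
  proof (rule eigenvalue_le_of_forms[OF B r A _ k, of _ "{v}"])
    show "Re ((?B *\<^sub>v x) \<bullet>c x) \<le> Re ((A *\<^sub>v x) \<bullet>c x)"
      if "x \<in> carrier_vec M" "\<forall>g\<in>{v}. x \<bullet>c g = 0" for x
      unfolding form[OF that(1)] using that(2) by simp
  qed (use k k' v in auto)
qed

section \<open>The sign of the residues\<close>

text \<open>Let \<open>i\<close> be the first index with \<open>s\<^sub>i = x\<close>. The factor \<open>t - x\<close> cancels \<open>t - s\<^sub>i\<close>. The factor \<open>t - r\<^sub>1\<close> is kept
  apart, each \<open>s\<^sub>j\<close> with \<open>j < i\<close> is paired with \<open>r\<^sub>j\<^sub>+\<^sub>1\<close>, and each \<open>s\<^sub>j\<close> with \<open>j > i\<close> with \<open>r\<^sub>j\<close>. By interlacing the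
  two members of a pair lie on the same side of \<open>x\<close> (or both equal \<open>x\<close>), so every quotient has a
  nonnegative limit, while \<open>x - r\<^sub>1 \<le> 0\<close>.\<close>

lemma interlacing_residue_nonpos:
  assumes s: "antimono_on {1..M} s" and ilc: "interlaces M r s" and x: "x \<in> s ` {1..M}"
  shows "\<exists>l\<le>0. ((\<lambda>t. (t - x) * (poly (spec_poly M r) t / poly (spec_poly M s) t)) \<longlongrightarrow> l) (at x)"
proof -
  have low: "s k \<le> r k" if "k \<in> {1..M}" for k using ilc that by (auto simp: interlaces_def)
  have up: "r (Suc k) \<le> s k" if "k \<in> {1..M}" "Suc k \<le> M" for k
    using ilc that unfolding interlaces_def pad_def by fastforce
  define i where "i = (LEAST j. j \<in> {1..M} \<and> s j = x)"
  obtain j0 where "j0 \<in> {1..M} \<and> s j0 = x" using x by blast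
  from LeastI[of "\<lambda>j. j \<in> {1..M} \<and> s j = x", OF this]
  have i: "i \<in> {1..M}" "s i = x" unfolding i_def by blast+
  have first: "s j > x" if "j \<in> {1..M}" "j < i" for j
    using not_less_Least[of j "\<lambda>j. j \<in> {1..M} \<and> s j = x"] antimono_on_atLeastAtMostD[OF s, of j i] that i
    unfolding i_def by force
  (* h assigns to the index of a denominator the index of the numerator it is paired with. *)
  define h where "h j = (if j < i then Suc j else j)" for j
  have bij: "bij_betw h ({1..M} - {i}) {2..M}"
    by (rule bij_betw_byWitness[where f' = "\<lambda>j. if j \<le> i then j - 1 else j"])
      (use i in \<open>auto simp: h_def\<close>)
  have num: "(\<Prod>m=1..M. t - r m) = (t - r 1) * (\<Prod>j\<in>{1..M} - {i}. t - r (h j))" for t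
  proof -
    have "(\<Prod>m=1..M. t - r m) = (t - r 1) * (\<Prod>m=2..M. t - r m)"
      using i by (subst prod.atLeast_Suc_atMost) (auto simp: numeral_2_eq_2)
    then show ?thesis using prod.reindex_bij_betw[OF bij, of "\<lambda>m. t - r m"] by simp
  qed
  have den: "(\<Prod>m=1..M. t - s m) = (t - x) * (\<Prod>j\<in>{1..M} - {i}. t - s j)" for t
    using prod.remove[of "{1..M}" i "\<lambda>m. t - s m"] i by simp
  have "\<exists>l\<ge>0. ((\<lambda>t. (t - r (h j)) / (t - s j)) \<longlongrightarrow> l) (at x)" if j: "j \<in> {1..M} - {i}" for j
  proof -
    have *: "?thesis" if "x \<noteq> s j" "0 \<le> (x - r (h j)) / (x - s j)"
    proof -
      have "((\<lambda>t. (t - r (h j)) / (t - s j)) \<longlongrightarrow> (x - r (h j)) / (x - s j)) (at x)"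
        using that by (intro tendsto_intros) auto
      then show ?thesis using that by blast
    qed
    consider "j < i" | "j > i" "s j = x" | "j > i" "s j \<noteq> x" using j by force
    then show ?thesis
    proof cases
      case 1
      have "x \<le> s (Suc j)" using antimono_on_atLeastAtMostD[OF s, of "Suc j" i] i 1 by auto
      also have "\<dots> \<le> r (Suc j)" using low[of "Suc j"] i 1 by auto
      finally show ?thesis
        using first[of j] j 1 by (intro *) (auto simp: h_def intro: divide_nonpos_neg)
    next
      case 2
      have "j - 1 \<in> {1..M}" "Suc (j - 1) = j" using j 2 i by auto
      then have "r j \<le> s (j - 1)" using up[of "j - 1"] j by auto
      also have "\<dots> \<le> x" using antimono_on_atLeastAtMostD[OF s, of i "j - 1"] i 2 j by auto
      finally have "r j = s j" using low[of j] j 2 by auto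
      then have "\<forall>\<^sub>F t in at x. 1 = (t - r (h j)) / (t - s j)"
        using 2 by (auto simp: h_def eventually_at_filter)
      from Lim_transform_eventually[OF tendsto_const this]
      show ?thesis by (intro exI[of _ 1]) auto
    next
      case 3
      have "j - 1 \<in> {1..M}" "Suc (j - 1) = j" using j 3 i by auto
      then have "r j \<le> s (j - 1)" using up[of "j - 1"] j by auto
      also have "\<dots> \<le> x" using antimono_on_atLeastAtMostD[OF s, of i "j - 1"] i 3 j by auto
      finally have "r j \<le> x" .
      moreover have "s j < x" using antimono_on_atLeastAtMostD[OF s, of i j] i 3 j by force
      ultimately show ?thesis using 3 by (intro *) (auto simp: h_def)
    qed
  qed
  then obtain l where l: "\<And>j. j \<in> {1..M} - {i} \<Longrightarrow> 0 \<le> l j"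
      "\<And>j. j \<in> {1..M} - {i} \<Longrightarrow> ((\<lambda>t. (t - r (h j)) / (t - s j)) \<longlongrightarrow> l j) (at x)"
    by metis
  have "((\<lambda>t. (t - r 1) * (\<Prod>j\<in>{1..M} - {i}. (t - r (h j)) / (t - s j))) \<longlongrightarrow>
      (x - r 1) * (\<Prod>j\<in>{1..M} - {i}. l j)) (at x)"
    by (intro tendsto_intros l(2))
  moreover have "\<forall>\<^sub>F t in at x. (t - r 1) * (\<Prod>j\<in>{1..M} - {i}. (t - r (h j)) / (t - s j))
      = (t - x) * (poly (spec_poly M r) t / poly (spec_poly M s) t)"
    unfolding poly_spec_poly num den prod_dividef eventually_at_filter by (auto intro!: always_eventually)
  ultimately have "((\<lambda>t. (t - x) * (poly (spec_poly M r) t / poly (spec_poly M s) t)) \<longlongrightarrow>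
      (x - r 1) * (\<Prod>j\<in>{1..M} - {i}. l j)) (at x)"
    by (rule Lim_transform_eventually)
  moreover have "x \<le> r 1" using antimono_on_atLeastAtMostD[OF s, of 1 i] low[of 1] i by auto
  then have "(x - r 1) * (\<Prod>j\<in>{1..M} - {i}. l j) \<le> 0"
    using l(1) by (intro mult_nonpos_nonneg prod_nonneg) auto
  ultimately show ?thesis by blast
qed

section \<open>Frame operators\<close>

lemma frame_op_carrier [simp]: "frame_op M n f \<in> carrier_mat M M"
  by (auto simp: frame_op_def synth_def mat_adjoint_def)

lemma frame_op_dim [simp]: "dim_row (frame_op M n f) = M" "dim_col (frame_op M n f) = M"
  using carrier_matD[OF frame_op_carrier[of M n f]] by auto

lemma frame_op_index:
  assumes "i < M" "j < M"
  shows "frame_op M n f $$ (i,j) = (\<Sum>m=1..n. f m $ i * cnj (f m $ j))"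
proof -
  let ?F = "synth M n f"
  have F: "?F \<in> carrier_mat M n" by (auto simp: synth_def)
  have Fi: "?F $$ (a,k) = f (Suc k) $ a" if "a < M" "k < n" for a k
    using that by (simp add: synth_def mat_of_cols_index del: upt_Suc)
  have ad: "mat_adjoint ?F \<in> carrier_mat n M" using F by (auto simp: mat_adjoint_def)
  have adi: "mat_adjoint ?F $$ (k,a) = cnj (?F $$ (a,k))" if "a < M" "k < n" for a k
    using that F by (simp add: mat_adjoint_def mat_of_rows_index)
  have "frame_op M n f $$ (i,j) = (\<Sum>k<n. ?F $$ (i,k) * mat_adjoint ?F $$ (k,j))"
    using assms F ad by (simp add: frame_op_def scalar_prod_def atLeast0LessThan)
  also have "\<dots> = (\<Sum>k<n. f (Suc k) $ i * cnj (f (Suc k) $ j))"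
    using assms by (intro sum.cong refl) (simp add: Fi adi)
  also have "\<dots> = (\<Sum>m=1..n. f m $ i * cnj (f m $ j))"
    by (simp add: sum.atLeast1_atMost_eq)
  finally show ?thesis .
qed

lemma frame_op_0: "frame_op M 0 f = 0\<^sub>m M M"
proof (rule eq_matI)
  fix i j assume "i < dim_row (0\<^sub>m M M :: complex mat)" "j < dim_col (0\<^sub>m M M :: complex mat)"
  then show "frame_op M 0 f $$ (i,j) = 0\<^sub>m M M $$ (i,j)" by (simp add: frame_op_index)
qed auto

lemma frame_op_Suc: "frame_op M (Suc n) f = frame_op M n f + rank_one M (f (Suc n))"
proof (rule eq_matI)
  fix i j assume "i < dim_row (frame_op M n f + rank_one M (f (Suc n)))"
    "j < dim_col (frame_op M n f + rank_one M (f (Suc n)))"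
  then have "i < M" "j < M" by auto
  then show "frame_op M (Suc n) f $$ (i,j) = (frame_op M n f + rank_one M (f (Suc n))) $$ (i,j)"
    by (simp add: frame_op_index rank_one_def)
qed auto

lemma frame_op_cong:
  assumes "\<And>m. m \<in> {1..n} \<Longrightarrow> f m = g m"
  shows "frame_op M n f = frame_op M n g"
proof -
  have "map f [1..<Suc n] = map g [1..<Suc n]" using assms by (auto simp del: upt_Suc)
  then show ?thesis by (simp only: frame_op_def synth_def)
qed

lemma self_adjoint_frame_op: "self_adjoint M (frame_op M n f)"
proof (induction n)
  case 0
  show ?case by (simp add: frame_op_0 self_adjoint_def)
next
  case (Suc n)
  then show ?case unfolding frame_op_Suc by (rule self_adjoint_add_rank_one)
qed

lemma has_spectrum_cong:
  assumes "\<And>k. k \<in> {1..M} \<Longrightarrow> s k = s' k" "has_spectrum M A s"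
  shows "has_spectrum M A s'"
proof -
  have "(\<Prod>m=1..M. [:- complex_of_real (s m), 1:]) = (\<Prod>m=1..M. [:- complex_of_real (s' m), 1:])"
    using assms(1) by (intro prod.cong) auto
  then show ?thesis using assms by (auto simp: has_spectrum_def monotone_on_def)
qed

lemma has_spectrum_zero_mat:
  assumes "has_spectrum M (0\<^sub>m M M) s" "k \<in> {1..M}"
  shows "s k = 0"
proof -
  have "self_adjoint M (0\<^sub>m M M)" by (simp add: self_adjoint_def)
  then obtain u where u: "eigenbasis M (0\<^sub>m M M) s u" using has_spectrum_eigenbasis assms(1) by blast
  note uD = orthonormal_eigenvectorsD[OF u]
  have "0\<^sub>m M M *\<^sub>v u k = 0\<^sub>v M" using uD(1)[OF assms(2)] by auto
  then have "complex_of_real (s k) * (u k \<bullet>c u k) = 0\<^sub>v M \<bullet>c u k"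
    using uD(1,2)[OF assms(2)] cscalar_prod_linear(3)[of "u k" M "u k" "u k"] by metis
  then show ?thesis using uD(1)[OF assms(2)] uD(3)[OF assms(2) assms(2)] by simp
qed

lemma mtrace_has_spectrum:
  assumes "A \<in> carrier_mat M M" "has_spectrum M A s"
  shows "mtrace A = of_real (\<Sum>m=1..M. s m)"
proof -
  let ?es = "map (\<lambda>m. complex_of_real (s m)) [1..<Suc M]"
  have "char_poly A = (\<Prod>e\<leftarrow>?es. [:- e, 1:])"
    using assms(2) prod.distinct_set_conv_list[of "[1..<Suc M]" "\<lambda>m. [:- complex_of_real (s m), 1:]"]
    by (simp add: has_spectrum_def o_def atLeastLessThanSuc_atLeastAtMost del: upt_Suc)
  then have "mtrace A = sum_list ?es" by (rule mtrace_eq_sum_list_eigenvalues[OF assms(1)])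
  also have "\<dots> = (\<Sum>m=1..M. complex_of_real (s m))"
    using sum.distinct_set_conv_list[of "[1..<Suc M]" "\<lambda>m. complex_of_real (s m)"]
    by (simp add: atLeastLessThanSuc_atLeastAtMost del: upt_Suc)
  finally show ?thesis by simp
qed

lemma sum_spectrum_add_rank_one:
  assumes A: "A \<in> carrier_mat M M" "has_spectrum M A s" and v: "v \<in> carrier_vec M"
    and r: "has_spectrum M (A + rank_one M v) r"
  shows "(\<Sum>m=1..M. r m) = (\<Sum>m=1..M. s m) + (vnorm v)\<^sup>2"
proof -
  have "mtrace (A + rank_one M v) = mtrace A + v \<bullet>c v"
    using A v by (simp add: mtrace_def rank_one_def sum.distrib cscalar_prod_sum[of _ M])
  then have "complex_of_real (\<Sum>m=1..M. r m) = of_real ((\<Sum>m=1..M. s m) + (vnorm v)\<^sup>2)"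
    using mtrace_has_spectrum[OF A] mtrace_has_spectrum[OF _ r] A vnorm_sq(2)[OF v] by simp
  then show ?thesis using of_real_eq_iff by blast
qed

section \<open>Eigensteps of a frame\<close>

text \<open>Starting from the zero matrix, interlacing makes the spectra nonnegative, and pushes the last
  possibly nonzero index up by at most one with each vector. The sum of the first \<open>k - 1\<close> entries of row \<open>n\<close> is
  at least that of row \<open>k - 1\<close>, which is its whole trace \<open>\<mu>\<^sub>1 + \<dots> + \<mu>\<^sub>k\<^sub>-\<^sub>1\<close>; subtracting from the trace of row \<open>n\<close>
  gives the tail inequality.\<close>

lemma eigensteps_of_frame:
  assumes f: "\<And>n. n \<in> {1..N} \<Longrightarrow> f n \<in> carrier_vec M" "\<And>n. n \<in> {1..N} \<Longrightarrow> (vnorm (f n))\<^sup>2 = mu n"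
    and L: "\<And>n. n \<le> N \<Longrightarrow> has_spectrum M (frame_op M n f) (L n)"
  shows "eigensteps M N mu L"
proof -
  have fS: "f (Suc n) \<in> carrier_vec M" if "Suc n \<le> N" for n using f(1)[of "Suc n"] that by auto
  have LS: "has_spectrum M (frame_op M n f + rank_one M (f (Suc n))) (L (Suc n))" if "Suc n \<le> N" for n
    using L[OF that] by (simp add: frame_op_Suc)
  have up: "L n k \<le> L (Suc n) k" if "Suc n \<le> N" "k \<in> {1..M}" for n k
    using interlacing_add_rank_one(1)[OF self_adjoint_frame_op L fS LS] that by simp
  have down: "L (Suc n) (Suc k) \<le> L n k" if "Suc n \<le> N" "k \<in> {1..M}" "Suc k \<le> M" for n k
    using interlacing_add_rank_one(2)[OF self_adjoint_frame_op L fS LS] that by simp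
  have L0: "L 0 k = 0" if "k \<in> {1..M}" for k
    using has_spectrum_zero_mat[OF _ that] L[of 0] by (simp add: frame_op_0)
  have nn: "0 \<le> L n k" if "n \<le> N" "k \<in> {1..M}" for n k
    using that
  proof (induction n)
    case (Suc n)
    then show ?case using up[of n k] by auto
  qed (simp add: L0)
  have zero: "L n k = 0" if "n \<le> N" "n < k" "k \<le> M" for n k
    using that
  proof (induction n arbitrary: k)
    case (Suc n)
    then obtain k' where "k = Suc k'" by (cases k) auto
    then have "L (Suc n) k \<le> L n k'" "L n k' = 0" using Suc down[of n k'] by auto
    then show ?case using nn[of "Suc n" k] Suc.prems by auto
  qed (simp add: L0)
  have tot: "(\<Sum>m=1..M. L n m) = (\<Sum>m=1..n. mu m)" if "n \<le> N" for n
    using that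
  proof (induction n)
    case (Suc n)
    then show ?case
      using sum_spectrum_add_rank_one[OF frame_op_carrier L fS LS, of n] f(2)[of "Suc n"] by simp
  qed (simp add: L0)
  have mono: "L m k \<le> L n k" if "m \<le> n" "n \<le> N" "k \<in> {1..M}" for m n k
    using that(1,2)
  proof (induction n rule: dec_induct)
    case (step n)
    then show ?case using up[of n k] that(3) by auto
  qed simp
  have tail: "(\<Sum>m=k..M. L n m) \<le> (\<Sum>m=k..n. mu m)" if n: "n \<le> N" and k: "k \<in> {1..M}" for n k
  proof (cases "k - 1 \<le> n")
    case True
    have "(\<Sum>m=1..k-1. mu m) = (\<Sum>m=1..M. L (k-1) m)" using tot[of "k-1"] True n by simp
    also have "\<dots> = (\<Sum>m=1..k-1. L (k-1) m)"
      using k True n by (intro sum.mono_neutral_right) (auto intro!: zero)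
    also have "\<dots> \<le> (\<Sum>m=1..k-1. L n m)"
      using k True n by (intro sum_mono mono) auto
    finally have "(\<Sum>m=1..k-1. mu m) \<le> (\<Sum>m=1..k-1. L n m)" .
    moreover have "1 \<le> k" "k - 1 \<le> M" using k by auto
    ultimately show ?thesis
      using sum_split_at[of k n mu] sum_split_at[of k M "L n"] tot[OF n] True by auto
  next
    case False
    then have "(\<Sum>m=k..M. L n m) = 0" using zero[OF n] by (intro sum.neutral) auto
    then show ?thesis using False by simp
  qed
  have "good_row M mu n (L n)" if "n \<in> {1..N}" for n
    using L[of n] nn[of n] zero[of n] tail[of n] tot[of n] that
    by (auto simp: good_row_def has_spectrum_def)
  moreover have "interlaces M (L (Suc n)) (L n)" if "n \<in> {1..<N}" for n
    unfolding interlaces_def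
  proof
    fix k assume "k \<in> {1..M}"
    then show "pad M (L (Suc n)) (k + 1) \<le> L n k \<and> L n k \<le> L (Suc n) k"
      using that up[of n k] down[of n k] nn[of n k] by (auto simp: pad_def)
  qed
  ultimately show ?thesis by (auto simp: eigensteps_def)
qed

lemma residue_fun_eq:
  "residue_fun M L n x = (\<lambda>t. (t - x) * (poly (spec_poly M (L (Suc n))) t / poly (spec_poly M (L n)) t))"
  by (simp add: residue_fun_def fun_eq_iff)

text \<open>The matrix \<open>f\<^sub>1 f\<^sub>1\<^sup>*\<close> is a perturbation of the zero matrix, so interlacing leaves it one eigenvalue that
  can be nonzero, and the trace fixes it. After that, the condition of Step B and the residue formula
  give the same residues for the prescribed polynomial and the actual one, and the lengths are
  differences of traces.\<close>

lemma stepB_spectra: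
  assumes M: "1 \<le> M" and L: "eigensteps M N mu L" and B: "stepB M mu L n f" and n: "n \<le> N"
    and j: "j \<in> {1..n}"
  shows "f j \<in> carrier_vec M \<and> (vnorm (f j))\<^sup>2 = mu j \<and> has_spectrum M (frame_op M j f) (L j)"
proof -
  have good: "good_row M mu i (L i)" if "i \<in> {1..N}" for i using L that by (auto simp: eigensteps_def)
  from j have "1 \<le> j" "j \<le> n" by auto
  then show ?thesis
  proof (induction j rule: dec_induct)
    case base
    have f1: "f 1 \<in> carrier_vec M" "(vnorm (f 1))\<^sup>2 = mu 1" using B by (auto simp: stepB_def)
    obtain s where s: "has_spectrum M (frame_op M 0 f) s"
      using self_adjoint_has_spectrum[OF self_adjoint_frame_op] by blast
    obtain r where r: "has_spectrum M (frame_op M 1 f) r"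
      using self_adjoint_has_spectrum[OF self_adjoint_frame_op] by blast
    then have r': "has_spectrum M (frame_op M 0 f + rank_one M (f 1)) r"
      using frame_op_Suc[of M 0 f] by simp
    have s0: "s k = 0" if "k \<in> {1..M}" for k using has_spectrum_zero_mat[OF _ that] s by (simp add: frame_op_0)
    have r0: "r (Suc k) = 0" if "k \<in> {1..M}" "Suc k \<le> M" for k
      using interlacing_add_rank_one[OF self_adjoint_frame_op s f1(1) r', of k] that s0[of k]
        interlacing_add_rank_one(1)[OF self_adjoint_frame_op s f1(1) r', of "Suc k"] s0[of "Suc k"]
      by auto
    have good1: "good_row M mu 1 (L 1)" using good n base by auto
    have tl: "r k = L 1 k" if "k \<in> {1..M}" "k \<noteq> 1" for k
      using r0[of "k - 1"] good_rowD(3)[OF good1, of k] that by auto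
    have "(\<Sum>m=1..M. r m) = mu 1"
      using sum_spectrum_add_rank_one[OF frame_op_carrier s f1(1) r'] s0 f1(2) by simp
    also have "\<dots> = (\<Sum>m=1..M. L 1 m)" using good_rowD(5)[OF good1] by simp
    finally have "r 1 + (\<Sum>m=1+1..M. r m) = L 1 1 + (\<Sum>m=1+1..M. L 1 m)"
      using sum_pop_front[OF M] by simp
    moreover have "(\<Sum>m=1+1..M. r m) = (\<Sum>m=1+1..M. L 1 m)"
      using tl by (intro sum.cong) auto
    ultimately have "r k = L 1 k" if "k \<in> {1..M}" for k
      using tl[of k] that by (cases "k = 1") auto
    then show ?case using f1 has_spectrum_cong[OF _ r] by auto
  next
    case (step i)
    have choice: "stepB_choice M L f i (f (Suc i))"
      using B step by (auto simp: stepB_def)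
    then have fS: "f (Suc i) \<in> carrier_vec M" by (simp add: stepB_choice_def)
    have s: "has_spectrum M (frame_op M i f) (L i)" using step by auto
    obtain r where r: "has_spectrum M (frame_op M (Suc i) f) r"
      using self_adjoint_has_spectrum[OF self_adjoint_frame_op] by blast
    then have r': "has_spectrum M (frame_op M i f + rank_one M (f (Suc i))) r"
      by (simp add: frame_op_Suc)
    have goodS: "good_row M mu (Suc i) (L (Suc i))" and goodi: "good_row M mu i (L i)"
      using good n step by auto
    have "spec_poly M r = spec_poly M (L (Suc i))"
      by (rule spec_poly_eqI[OF residue_limit[OF self_adjoint_frame_op s fS r']])
        (use choice in \<open>auto simp: stepB_choice_def residue_fun_eq\<close>)
    then have sS: "has_spectrum M (frame_op M (Suc i) f) (L (Suc i))"
      using has_spectrum_if_spec_poly_eq[OF r] goodS by (simp add: good_row_def)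
    have "(vnorm (f (Suc i)))\<^sup>2 = mu (Suc i)"
      using sum_spectrum_add_rank_one[OF frame_op_carrier s fS sS[unfolded frame_op_Suc]]
        good_rowD(5)[OF goodS] good_rowD(5)[OF goodi] by simp
    then show ?case using fS sS by simp
  qed
qed

text \<open>For every eigenvalue one unit eigenvector suffices: scaled to the prescribed length, it carries the
  whole component of \<open>v\<close> in that eigenspace. The function \<open>inv_into\<close> selects its index.\<close>

lemma stepB_choice_exists:
  assumes s: "has_spectrum M (frame_op M n f) (L n)"
    and lim: "\<And>x. x \<in> L n ` {1..M} \<Longrightarrow> \<exists>l\<le>0. (residue_fun M L n x \<longlongrightarrow> l) (at x)"
  shows "\<exists>v. stepB_choice M L f n v"
proof -
  let ?s = "L n"
  note A = self_adjoint_frame_op[of M n f]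
  obtain u where u: "eigenbasis M (frame_op M n f) ?s u" using has_spectrum_eigenbasis[OF A s] by auto
  obtain l where l: "\<And>x. x \<in> ?s ` {1..M} \<Longrightarrow> l x \<le> 0"
    "\<And>x. x \<in> ?s ` {1..M} \<Longrightarrow> (residue_fun M L n x \<longlongrightarrow> l x) (at x)"
    using lim by metis
  define c where "c i = (if i = inv_into {1..M} ?s (?s i) then complex_of_real (sqrt (- l (?s i))) else 0)" for i
  obtain v where v: "v \<in> carrier_vec M" "\<And>k. k \<in> {1..M} \<Longrightarrow> v \<bullet>c u k = c k"
    using coords_exist[OF u, of c] by auto
  have "(vnorm (orth_proj (eigenspace M (frame_op M n f) (of_real x)) v))\<^sup>2 = - l x"
    if x: "x \<in> ?s ` {1..M}" for x
  proof -
    let ?i = "inv_into {1..M} ?s x"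
    have i: "?i \<in> {1..M}" "?s ?i = x" using inv_into_into[OF x] f_inv_into_f[OF x] by auto
    have "(vnorm (orth_proj (eigenspace M (frame_op M n f) (of_real x)) v))\<^sup>2
      = (\<Sum>i | i \<in> {1..M} \<and> ?s i = x. (cmod (v \<bullet>c u i))\<^sup>2)"
      by (rule orth_proj_eigenspace[OF A u v(1)])
    also have "\<dots> = (\<Sum>i | i \<in> {1..M} \<and> ?s i = x. if i = ?i then - l x else 0)"
      using v(2) l(1)[OF x] by (intro sum.cong refl) (auto simp: c_def)
    also have "\<dots> = - l x" using i by simp
    finally show ?thesis .
  qed
  then have "stepB_choice M L f n v" using v(1) l(2) by (auto simp: stepB_choice_def)
  then show ?thesis by blast
qed

lemma eigensteps_residues:
  assumes L: "eigensteps M N mu L" and n: "n \<in> {1..N-1}" and x: "x \<in> L n ` {1..M}"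
  shows "\<exists>l\<le>0. (residue_fun M L n x \<longlongrightarrow> l) (at x)"
  unfolding residue_fun_eq
  using L n by (intro interlacing_residue_nonpos[OF _ _ x]) (auto simp: eigensteps_def good_row_def)

lemma exists_vec_of_norm:
  assumes "1 \<le> M" "0 \<le> a"
  shows "\<exists>v\<in>carrier_vec M. (vnorm v)\<^sup>2 = a"
proof -
  let ?v = "vec M (\<lambda>j. if j = 0 then complex_of_real (sqrt a) else 0)"
  have "(vnorm ?v)\<^sup>2 = (\<Sum>j<M. (cmod (?v $ j))\<^sup>2)" by (rule vnorm_sq(1)) simp
  also have "\<dots> = (\<Sum>j<M. if j = 0 then a else 0)"
    using assms by (intro sum.cong refl) auto
  finally show ?thesis using assms by (intro bexI[of _ ?v]) auto
qed

lemma stepB_choice_cong: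
  assumes "\<And>m. m \<in> {1..n} \<Longrightarrow> f m = g m"
  shows "stepB_choice M L f n v = stepB_choice M L g n v"
  using frame_op_cong[of n f g M] assms by (simp add: stepB_choice_def)

section \<open>Frames and the two-step process\<close>

theorem theorem1p4:
  fixes M N :: nat and lam mu :: "nat \<Rightarrow> real"
  assumes "1 \<le> M" and "M \<le> N"
    and "\<forall>m\<in>{1..M}. 0 \<le> lam m" and "antimono_on {1..M} lam"
    and "\<forall>n\<in>{1..N}. 0 \<le> mu n" and "antimono_on {1..N} mu"
  shows
    "((\<exists>f. frame_with M N lam mu f) \<longleftrightarrow> majorizes N (pad M lam) mu) \<and>
     (majorizes N (pad M lam) mu \<longrightarrow>
        \<comment> \<open>every such frame arises from the process\<close>
        (\<forall>f. frame_with M N lam mu f \<longrightarrow> (\<exists>L. stepA M N lam mu L \<and> stepB M mu L N f)) \<and>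
        \<comment> \<open>no choice in Step A is ever impossible\<close>
        (\<forall>L. \<forall>n\<in>{2..N}. \<forall>k\<in>{1..M}. k \<le> n - 1 \<and> stepA_before M N lam mu L n k \<longrightarrow>
            A_bound M mu L n k \<le> B_bound M mu L n k) \<and>
        \<comment> \<open>the limits exist and are nonpositive\<close>
        (\<forall>L. stepA M N lam mu L \<longrightarrow>
            (\<forall>n\<in>{1..N-1}. \<forall>x \<in> L n ` {1..M}.
                \<exists>l\<le>0. (residue_fun M L n x \<longlongrightarrow> l) (at x))) \<and>
        \<comment> \<open>no choice in Step B is ever impossible\<close>
        (\<exists>v \<in> carrier_vec M. (vnorm v)\<^sup>2 = mu 1) \<and>
        (\<forall>L f. \<forall>n\<in>{1..N-1}. stepA M N lam mu L \<and> stepB M mu L n f \<longrightarrow>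
            (\<exists>v. stepB_choice M L f n v)) \<and>
        \<comment> \<open>conversely, the process only produces such frames\<close>
        (\<forall>L f. stepA M N lam mu L \<and> stepB M mu L N f \<longrightarrow>
            frame_with M N lam mu f \<and>
            (\<forall>n\<in>{1..N}. has_spectrum M (frame_op M n f) (L n))))"
proof -
  have N: "1 \<le> N" using assms(1,2) by simp
  have mu1: "0 \<le> mu 1" using assms(5) N by auto
  have iff: "good_row M mu N lam \<longleftrightarrow> majorizes N (pad M lam) mu"
    using good_row_iff_majorizes[OF assms(1-5)] .
  have to_process: "good_row M mu N lam \<and> (\<exists>L. stepA M N lam mu L \<and> stepB M mu L N f)"
    if F: "frame_with M N lam mu f" for f
  proof -
    have f: "\<And>n. n \<in> {1..N} \<Longrightarrow> f n \<in> carrier_vec M" "\<And>n. n \<in> {1..N} \<Longrightarrow> (vnorm (f n))\<^sup>2 = mu n"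
      and spec: "has_spectrum M (frame_op M N f) lam"
      using F by (auto simp: frame_with_def)
    have "\<forall>n. \<exists>s. has_spectrum M (frame_op M n f) s"
      using self_adjoint_has_spectrum[OF self_adjoint_frame_op] by blast
    from choice[OF this] obtain L0 where L0: "\<And>n. has_spectrum M (frame_op M n f) (L0 n)" by blast
    (* With lam itself as row N there is no need to compare it with the spectrum chosen in L0 N. *)
    define L where "L = L0(N := lam)"
    have L: "has_spectrum M (frame_op M n f) (L n)" for n
      using L0 spec by (simp add: L_def)
    have E: "eigensteps M N mu L"
      using eigensteps_of_frame[OF f L] by blast
    have "N \<in> {1..N}" using N by simp
    then have "good_row M mu N (L N)" using E unfolding eigensteps_def by blast
    then have g: "good_row M mu N lam" by (simp add: L_def)
    then have "stepA M N lam mu L"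
      using stepA_iff_eigensteps[OF assms(1) N g assms(5)] E by (simp add: L_def)
    moreover have "stepB M mu L N f"
      unfolding stepB_def stepB_choice_def
    proof (intro conjI ballI)
      fix j x assume j: "j \<in> {1..<N}"
      then have fS: "f (Suc j) \<in> carrier_vec M" using f(1) by auto
      then show "f (j + 1) \<in> carrier_vec M" by simp
      show "(residue_fun M L j x \<longlongrightarrow> - (vnorm (orth_proj (eigenspace M (frame_op M j f) (complex_of_real x)) (f (j + 1))))\<^sup>2) (at x)"
        using residue_limit[OF self_adjoint_frame_op L fS L[of "Suc j", unfolded frame_op_Suc]]
        by (simp add: residue_fun_eq)
    qed (use f N in auto)
    ultimately show ?thesis using g by blast
  qed
  have eig: "eigensteps M N mu L \<and> (\<forall>m\<in>{1..M}. L N m = lam m)"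
    if "good_row M mu N lam" "stepA M N lam mu L" for L
    using stepA_iff_eigensteps[OF assms(1) N that(1) assms(5)] that(2) by blast
  have from_process: "frame_with M N lam mu f \<and> (\<forall>n\<in>{1..N}. has_spectrum M (frame_op M n f) (L n))"
    if g: "good_row M mu N lam" and A: "stepA M N lam mu L" and B: "stepB M mu L N f" for L f
  proof -
    note E = eig[OF g A]
    have sp: "f n \<in> carrier_vec M \<and> (vnorm (f n))\<^sup>2 = mu n \<and> has_spectrum M (frame_op M n f) (L n)"
      if "n \<in> {1..N}" for n
      using stepB_spectra[OF assms(1) conjunct1[OF E] B] that by simp
    then have "has_spectrum M (frame_op M N f) lam"
      using has_spectrum_cong[of M "L N" lam] E N by auto
    then show ?thesis using sp by (auto simp: frame_with_def)
  qed
  have choiceB: "\<exists>v. stepB_choice M L f n v"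
    if "good_row M mu N lam" "stepA M N lam mu L" "n \<in> {1..N-1}" "stepB M mu L n f" for L f n
  proof (rule stepB_choice_exists)
    have E: "eigensteps M N mu L" using eig that by blast
    show "has_spectrum M (frame_op M n f) (L n)"
      using stepB_spectra[OF assms(1) E that(4)] that(3) by auto
    show "\<exists>l\<le>0. (residue_fun M L n x \<longlongrightarrow> l) (at x)" if "x \<in> L n ` {1..M}" for x
      using eigensteps_residues[OF E \<open>n \<in> {1..N-1}\<close> that] .
  qed
  have process_exists: "\<exists>f. frame_with M N lam mu f" if g: "good_row M mu N lam"
  proof -
    obtain L where L: "stepA M N lam mu L" using stepA_exists[OF g assms(5,6)] by blast
    have "\<exists>f. stepB M mu L n f" if "1 \<le> n" "n \<le> N" for n
      using that
    proof (induction n rule: dec_induct)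
      case base
      obtain v where "v \<in> carrier_vec M" "(vnorm v)\<^sup>2 = mu 1"
        using exists_vec_of_norm[OF assms(1) mu1] by blast
      then have "stepB M mu L 1 (\<lambda>_. v)" by (simp add: stepB_def)
      then show ?case by blast
    next
      case (step n)
      then obtain f where f: "stepB M mu L n f" by auto
      have "n \<in> {1..N-1}" using step by auto
      then obtain v where v: "stepB_choice M L f n v" using choiceB[OF g L _ f] by blast
      let ?f = "f(Suc n := v)"
      have "stepB_choice M L ?f j w = stepB_choice M L f j w" if "j \<le> n" for j w
        using that by (intro stepB_choice_cong) auto
      then have "stepB M mu L (Suc n) ?f"
        using f v step by (auto simp: stepB_def less_Suc_eq)
      then show ?case by blast
    qed
    then obtain f where "stepB M mu L N f" using N by blast
    then show ?thesis using from_process[OF g L] by blast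
  qed
  show ?thesis
    unfolding iff[symmetric]
  proof (intro conjI impI allI ballI)
    show "(\<exists>f. frame_with M N lam mu f) \<longleftrightarrow> good_row M mu N lam"
      using to_process process_exists by blast
  next
    fix L n k assume "good_row M mu N lam" "n \<in> {2..N}" "k \<in> {1..M}"
      "k \<le> n - 1 \<and> stepA_before M N lam mu L n k"
    then show "A_bound M mu L n k \<le> B_bound M mu L n k"
      using choice_possible_before[OF _ assms(5,6)] by blast
  next
    fix L n x assume "good_row M mu N lam" "stepA M N lam mu L" "n \<in> {1..N-1}" "x \<in> L n ` {1..M}"
    then show "\<exists>l\<le>0. (residue_fun M L n x \<longlongrightarrow> l) (at x)"
      using eig eigensteps_residues by blast
  next
    show "\<exists>v\<in>carrier_vec M. (vnorm v)\<^sup>2 = mu 1"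
      using exists_vec_of_norm[OF assms(1) mu1] .
  next
    fix L f n assume "good_row M mu N lam" "n \<in> {1..N-1}" "stepA M N lam mu L \<and> stepB M mu L n f"
    then show "\<exists>v. stepB_choice M L f n v" using choiceB by blast
  qed (use to_process from_process in blast)+
qed

end
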